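(* Let $G$ be a finite simple undirected graph that is $(P_4 \cup K_1)$-free and has maximum degree $\Delta(G) \ge 9$. Then $\chi(G) \le \max\{\Delta(G)-1, \omega(G)\}$.
   Context: All graphs are finite, simple and undirected. For a graph $G$: $\Delta(G)$ is the maximum degree, $\omega(G)$ the size of a maximum clique, $\chi(G)$ the chromatic number. $P_4 \cup K_1$ denotes the disjoint union of a path on $4$ vertices and a single isolated vertex. A graph is $H$-free if it has no induced subgraph isomorphic to $H$. *)

theory Defs
  imports "Graph_Theory.Graph_Theory"
begin

text \<open>
  A finite simple undirected graph is a \<^const>\<open>pair_graph\<close>: a finite vertex set
  together with a finite, symmetric and irreflexive arc relation on it, so that an undirected
  edge is a pair of opposite arcs.
\<close>

subsection \<open>Graph parameters\<close>

text \<open>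
  By symmetry of the arc relation, the degree of a vertex is its out-degree.  Inserting 0
  fixes the value for the graph without vertices, where \<^const>\<open>Max\<close> is unspecified.
\<close>

definition max_degree :: "'a pair_pre_digraph \<Rightarrow> nat" where
  "max_degree G = Max (insert 0 (out_degree (with_proj G) ` pverts G))"

definition is_clique :: "'a pair_pre_digraph \<Rightarrow> 'a set \<Rightarrow> bool" where
  "is_clique G C \<longleftrightarrow> C \<subseteq> pverts G \<and> (\<forall>u\<in>C. \<forall>v\<in>C. u \<noteq> v \<longrightarrow> (u, v) \<in> parcs G)"

definition clique_number :: "'a pair_pre_digraph \<Rightarrow> nat" where
  "clique_number G = Max (card ` {C. is_clique G C})"

definition proper_colouring :: "'a pair_pre_digraph \<Rightarrow> nat \<Rightarrow> ('a \<Rightarrow> nat) \<Rightarrow> bool" where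
  "proper_colouring G k f \<longleftrightarrow>
     (\<forall>v\<in>pverts G. f v < k) \<and> (\<forall>(u, v)\<in>parcs G. f u \<noteq> f v)"

definition chromatic_number :: "'a pair_pre_digraph \<Rightarrow> nat" where
  "chromatic_number G = (LEAST k. \<exists>f. proper_colouring G k f)"

subsection \<open>Forbidden induced subgraphs\<close>

definition free_of :: "'a pair_pre_digraph \<Rightarrow> 'b pair_pre_digraph \<Rightarrow> bool" where
  "free_of G H \<longleftrightarrow>
     \<not> (\<exists>K :: 'a pair_pre_digraph.
          induced_subgraph (with_proj K) (with_proj G) \<and> digraph_iso (with_proj H) (with_proj K))"

definition path_graph :: "nat \<Rightarrow> nat pair_pre_digraph" where
  "path_graph n =
     \<lparr> pverts = {..<n}, parcs = {(i, j). i < n \<and> j < n \<and> (j = Suc i \<or> i = Suc j)} \<rparr>"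

definition complete_graph :: "nat \<Rightarrow> nat pair_pre_digraph" where
  "complete_graph n = \<lparr> pverts = {..<n}, parcs = {(i, j). i < n \<and> j < n \<and> i \<noteq> j} \<rparr>"

definition disjoint_union ::
    "'a pair_pre_digraph \<Rightarrow> 'b pair_pre_digraph \<Rightarrow> ('a + 'b) pair_pre_digraph" where
  "disjoint_union G H =
     \<lparr> pverts = pverts G <+> pverts H,
       parcs = map_prod Inl Inl ` parcs G \<union> map_prod Inr Inr ` parcs H \<rparr>"

definition P4_K1 :: "(nat + nat) pair_pre_digraph" where
  "P4_K1 = disjoint_union (path_graph 4) (complete_graph 1)"

end

theory Submission
  imports Defs
begin

text \<open>
  Put \<open>k = max (\<Delta> - 1) \<omega>\<close>, so that \<open>k \<ge> 8\<close>, all degrees are at most \<open>k + 1\<close>, and no clique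
  has more than \<open>k\<close> vertices.  If \<open>G\<close> has no proper colouring with \<open>k\<close> colours, a smallest
  vertex set inducing a subgraph without such a colouring gives a critical graph: removing any
  vertex \<open>v\<close> leaves a \<open>k\<close>-colourable graph.  The proof shows that there is no such critical
  graph (\<open>no_critical_graph\<close>).

  Fix a \<open>k\<close>-colouring of the graph without \<open>v\<close>.  All colours occur around \<open>v\<close>, and since
  \<open>v\<close> has at most \<open>k + 1\<close> neighbours, at most one colour occurs there more than once.  If a
  colour occurs at a single neighbour \<open>u\<close>, then \<open>v\<close> can take that colour and \<open>u\<close> becomes the
  uncoloured vertex, so \<open>u\<close> satisfies the same constraints.  Suppose that two such unique
  neighbours \<open>u\<close>, \<open>w\<close> are not adjacent.  They are joined by a Kempe chain in their two colours.
  As the non-neighbours of \<open>v\<close> induce no \<open>P\<^sub>4\<close>, the chain has exactly two inner vertices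
  (\<open>kempe\<close>), which gives an induced pentagon through \<open>v\<close>; and every vertex of the graph has at
  least two neighbours on an induced pentagon (\<open>pentagon_two_nbrs\<close>).

  The decisive case is that the two colours occur on the pentagon only (\<open>no_ring\<close>).  Then the
  hole can be moved around the pentagon, so each of its five vertices sees each of the other
  \<open>k - 2\<close> colours, and at most one of them twice.  As \<open>k - 2 \<ge> 6\<close>, some colour is seen exactly
  once by all five vertices.  Kempe chains show that all five see it at the same vertex, which
  is thus adjacent to the pentagon and to the remaining \<open>k - 3\<close> colours: its degree would be
  at least \<open>k + 2\<close>.  (For \<open>k = 7\<close> the argument breaks down, and the lexicographic product
  of the pentagon with a triangle is a counterexample.)  If one or both of the two colours
  occur once more outside the pentagon, similar counts and recolourings apply
  (\<open>config_class_larger\<close>, \<open>no_config\<close>).  Hence the unique neighbours of an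
  uncoloured vertex are pairwise adjacent (\<open>unique_nbrs_adjacent\<close>).

  So every vertex \<open>v\<close> lies in a clique \<open>Q\<close> with \<open>k\<close> vertices, formed by \<open>v\<close> and its unique
  neighbours; one colour \<open>e\<close> occurs at exactly two neighbours of \<open>v\<close>.
  No \<open>k - 1\<close> pairwise adjacent vertices have two non-adjacent common neighbours
  (\<open>no_double_apex\<close>), and moving the hole within \<open>Q\<close> now shows that every vertex of \<open>Q\<close> has
  exactly two neighbours outside \<open>Q\<close>, both of colour \<open>e\<close> (\<open>monochromatic_boundary\<close>).
  Recolouring two suitable vertices of colour \<open>e\<close> lets the colouring be extended to \<open>Q\<close> by
  Hall's theorem, which is a contradiction.
\<close>

section \<open>Colourings of critical graphs with one hole\<close>

text \<open>
  The assumption \<open>dominating_P4\<close> is the absence of an induced \<open>P\<^sub>4 \<union> K\<^sub>1\<close>, read as a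
  property of induced paths.
\<close>

locale critical_graph =
  fixes V :: "'a set" and E :: "'a \<Rightarrow> 'a \<Rightarrow> bool" and k :: nat
  assumes finite_V: "finite V"
    and edge_in: "E x y \<Longrightarrow> x \<in> V"
    and edge_sym: "E x y \<Longrightarrow> E y x"
    and edge_irrefl: "\<not> E x x"
    and dominating_P4: "\<lbrakk>E a b; E b c; E c d; \<not> E a c; \<not> E a d; \<not> E b d; x \<in> V\<rbrakk>
      \<Longrightarrow> E x a \<or> E x b \<or> E x c \<or> E x d"
    and degree_le: "x \<in> V \<Longrightarrow> card {y. E x y} \<le> k + 1"
    and clique_le: "\<lbrakk>C \<subseteq> V; \<And>x y. \<lbrakk>x \<in> C; y \<in> C; x \<noteq> y\<rbrakk> \<Longrightarrow> E x y\<rbrakk> \<Longrightarrow> card C \<le> k"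
    and k_ge: "8 \<le> k"
    and not_colourable: "(\<And>x. x \<in> V \<Longrightarrow> f x < k) \<Longrightarrow> \<exists>x y. E x y \<and> f x = f y"
    and critical: "v \<in> V \<Longrightarrow> \<exists>f. (\<forall>x\<in>V - {v}. f x < k) \<and>
      (\<forall>x\<in>V - {v}. \<forall>y\<in>V - {v}. E x y \<longrightarrow> f x \<noteq> f y)"
begin

lemma edge_in2: "E x y \<Longrightarrow> y \<in> V"
  using edge_in edge_sym by blast

lemma finite_nbrs: "finite {y. E x y}"
  by (rule finite_subset[OF _ finite_V]) (auto intro: edge_in2)

lemma edge_commute: "E x y \<longleftrightarrow> E y x"
  using edge_sym by blast

definition proper :: "('a \<Rightarrow> nat) \<Rightarrow> bool" where
  "proper f \<longleftrightarrow> (\<forall>x y. E x y \<longrightarrow> f x \<noteq> f y)"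

text \<open>
  A \<open>k\<close>-colouring of the graph without \<open>v\<close>, with the additional colour \<open>k\<close> marking the
  uncoloured vertex.  In this encoding the map is proper on the whole graph, and the hole is a
  colour class like any other.
\<close>

definition hole :: "'a \<Rightarrow> ('a \<Rightarrow> nat) \<Rightarrow> bool" where
  "hole v f \<longleftrightarrow> v \<in> V \<and> f v = k \<and> (\<forall>x\<in>V. x \<noteq> v \<longrightarrow> f x < k) \<and> proper f"

lemma proper_update:
  assumes "proper f" "\<And>y. E x y \<Longrightarrow> f y \<noteq> c"
  shows "proper (f(x := c))"
  using assms edge_sym edge_irrefl unfolding proper_def by (metis fun_upd_apply)

lemma proper_large: "proper f \<Longrightarrow> \<exists>x\<in>V. k \<le> f x"
  using not_colourable[of f] unfolding proper_def by (meson not_le)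

lemma hole_proper: "hole v f \<Longrightarrow> proper f"
  by (simp add: hole_def)

lemma hole_edge: "hole v f \<Longrightarrow> E x y \<Longrightarrow> f x \<noteq> f y"
  by (simp add: hole_def proper_def)

lemma hole_less: "hole v f \<Longrightarrow> x \<in> V \<Longrightarrow> x \<noteq> v \<Longrightarrow> f x < k"
  by (simp add: hole_def)

lemma hole_nbr_less: "hole v f \<Longrightarrow> E v u \<Longrightarrow> f u < k"
  by (rule hole_less) (auto intro: edge_in2 simp: edge_irrefl)

lemma hole_exists:
  assumes "v \<in> V" shows "\<exists>f. hole v f"
proof -
  obtain f where f: "\<forall>x\<in>V - {v}. f x < k" "\<forall>x\<in>V - {v}. \<forall>y\<in>V - {v}. E x y \<longrightarrow> f x \<noteq> f y"
    using critical[OF assms] by blast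
  have "(f(v := k)) x \<noteq> (f(v := k)) y" if "E x y" for x y
    using f that edge_in[OF that] edge_in2[OF that] edge_irrefl by (auto simp: nat_neq_iff)
  then have "hole v (f(v := k))"
    using assms f by (auto simp: hole_def proper_def)
  then show ?thesis by blast
qed

lemma hole_update:
  assumes "hole v f" "x \<noteq> v" "c < k" "\<And>y. E x y \<Longrightarrow> f y \<noteq> c"
  shows "hole v (f(x := c))"
  using assms proper_update[of f x c] by (auto simp: hole_def)

lemma hole_sees:
  assumes "hole v f" "j < k" shows "\<exists>x. E v x \<and> f x = j"
proof (rule ccontr)
  assume "\<not> ?thesis"
  then have "proper (f(v := j))"
    using assms by (intro proper_update) (auto simp: hole_def)
  from proper_large[OF this] assms show False
    by (auto simp: hole_def not_le split: if_splits)
qed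

text \<open>
  If \<open>u\<close> is the only neighbour of the hole with its colour, the hole can take this colour at
  the price of uncolouring \<open>u\<close>.
\<close>

lemma hole_shift:
  assumes "hole v f" "E v u" "\<And>x. E v x \<Longrightarrow> f x = f u \<Longrightarrow> x = u"
  shows "hole u (f(v := f u, u := k))"
proof -
  have uV: "u \<in> V" "u \<noteq> v" and fu: "f u < k"
    using assms edge_in2 edge_irrefl hole_nbr_less by auto
  have vV: "v \<in> V" using assms by (simp add: hole_def)
  have 1: "f x \<noteq> f y" if "E x y" for x y using assms(1) that by (rule hole_edge)
  have 2: "f x < k" if "x \<in> V" "x \<noteq> v" for x using assms(1) that by (rule hole_less)
  have "(f(v := f u, u := k)) x \<noteq> (f(v := f u, u := k)) y" if e: "E x y" for x y
  proof -
    have xy: "x \<in> V" "y \<in> V" "x \<noteq> y" using e edge_in edge_in2 edge_irrefl by auto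
    have "f y \<noteq> f u" if "x = v" "y \<noteq> u" using assms(3) e that by blast
    moreover have "f x \<noteq> f u" if "y = v" "x \<noteq> u" using assms(3) e that edge_sym by blast
    ultimately show ?thesis using xy 1[OF e] 2[of x] 2[of y] uV fu by auto
  qed
  then show ?thesis using uV vV 2 fu by (auto simp: hole_def proper_def)
qed

lemma unique_sees:
  assumes "hole v f" "E v u" "\<And>x. E v x \<Longrightarrow> f x = f u \<Longrightarrow> x = u" "j < k" "j \<noteq> f u"
  shows "\<exists>x. E u x \<and> f x = j"
proof -
  obtain x where x: "E u x" "(f(v := f u, u := k)) x = j"
    using hole_sees[OF hole_shift[OF assms(1-3)] assms(4)] by blast
  then show ?thesis using assms(4,5) by (auto split: if_splits)
qed

definition twice :: "('a \<Rightarrow> nat) \<Rightarrow> 'a \<Rightarrow> nat \<Rightarrow> bool" where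
  "twice f x j \<longleftrightarrow> (\<exists>y z. y \<noteq> z \<and> E x y \<and> E x z \<and> f y = j \<and> f z = j)"

lemma not_twiceD: "\<not> twice f x j \<Longrightarrow> E x y \<Longrightarrow> E x z \<Longrightarrow> f y = j \<Longrightarrow> f z = j \<Longrightarrow> y = z"
  by (auto simp: twice_def)

text \<open>
  The source of all bounds on multiplicities: a vertex that sees every colour of \<open>J\<close> spends one
  edge on each of them, a second edge on each colour that it sees twice, and in addition the
  edges to \<open>S\<close>.
\<close>

lemma degree_budget:
  assumes x: "x \<in> V" and S: "\<And>y. y \<in> S \<Longrightarrow> E x y \<and> f y \<notin> J" and J: "finite J"
    and sees: "\<And>j. j \<in> J \<Longrightarrow> \<exists>y. E x y \<and> f y = j"
  shows "card S + card J + card {j \<in> J. twice f x j} \<le> k + 1"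
proof -
  define B where "B = {j \<in> J. twice f x j}"
  obtain g where g: "\<And>j. j \<in> J \<Longrightarrow> E x (g j) \<and> f (g j) = j"
    using sees by metis
  have "\<exists>y. E x y \<and> f y = j \<and> y \<noteq> g j" if j: "j \<in> B" for j
  proof -
    obtain y z where "y \<noteq> z" "E x y" "E x z" "f y = j" "f z = j"
      using j unfolding B_def twice_def by blast
    then show ?thesis by (cases "y = g j") auto
  qed
  then obtain h where h: "\<And>j. j \<in> B \<Longrightarrow> E x (h j) \<and> f (h j) = j \<and> h j \<noteq> g j"
    by metis
  have BJ: "B \<subseteq> J" by (auto simp: B_def)
  have fin: "finite S" "finite J" "finite B"
    using J BJ finite_subset finite_subset[OF _ finite_nbrs[of x], of S] S by auto
  have ig: "inj_on g J" and ih: "inj_on h B"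
    using g h by (metis inj_onI)+
  have "S \<inter> (g ` J \<union> h ` B) = {}" using S g h BJ by force
  moreover have "g i \<noteq> h j" if "i \<in> J" "j \<in> B" for i j
    using g[of i] h[of j] that by metis
  then have "g ` J \<inter> h ` B = {}" by auto
  ultimately have "card (S \<union> (g ` J \<union> h ` B)) = card S + (card J + card B)"
    using fin by (simp add: card_Un_disjoint card_image[OF ig] card_image[OF ih])
  moreover have "S \<union> (g ` J \<union> h ` B) \<subseteq> {y. E x y}" using S g h by auto
  then have "card (S \<union> (g ` J \<union> h ` B)) \<le> k + 1"
    using card_mono[OF finite_nbrs] degree_le[OF x] by (metis le_trans)
  ultimately show ?thesis by (simp add: B_def)
qed

definition pentagon :: "'a \<Rightarrow> 'a \<Rightarrow> 'a \<Rightarrow> 'a \<Rightarrow> 'a \<Rightarrow> bool" where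
  "pentagon a b c d e \<longleftrightarrow> E a b \<and> E b c \<and> E c d \<and> E d e \<and> E e a \<and>
     \<not> E a c \<and> \<not> E b d \<and> \<not> E c e \<and> \<not> E d a \<and> \<not> E e b"

lemma pentagon_rotate: "pentagon a b c d e \<Longrightarrow> pentagon b c d e a"
  by (auto simp: pentagon_def)

lemma pentagon_reflect: "pentagon a b c d e \<Longrightarrow> pentagon a e d c b"
  by (auto simp: pentagon_def edge_commute)

section \<open>Kempe chains and induced pentagons\<close>

lemma pentagon_dominating:
  assumes "pentagon a b c d e" "x \<in> V"
  shows "E x a \<or> E x b \<or> E x c \<or> E x d"
  using assms unfolding pentagon_def
  by (intro dominating_P4) (auto simp: edge_commute)

text \<open>
  Since every four vertices of the pentagon form an induced path, three non-neighbours on the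
  pentagon force adjacency to the other two vertices.
\<close>

lemma pentagon_two_nbrs:
  assumes "pentagon a b c d e" "x \<in> V"
  shows "E x a \<or> E x b \<or> E x c \<or> E x d" "E x b \<or> E x c \<or> E x d \<or> E x e"
    "E x c \<or> E x d \<or> E x e \<or> E x a" "E x d \<or> E x e \<or> E x a \<or> E x b"
    "E x e \<or> E x a \<or> E x b \<or> E x c"
  using pentagon_dominating assms pentagon_rotate by meson+

text \<open>
  Exchanging the colours \<open>f u\<close> and \<open>j\<close> on the chain of \<open>u\<close> would free the colour of \<open>u\<close> for the
  hole, unless the chain reaches a neighbour of the hole with colour \<open>j\<close>.  Up to that point the
  chain stays, apart from \<open>u\<close>, among the non-neighbours of \<open>v\<close>.  These induce no \<open>P\<^sub>4\<close>, so the
  chain reaches such a neighbour after one or three edges.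
\<close>

lemma kempe:
  assumes h: "hole v f" and u: "E v u" and uniq: "\<And>x. E v x \<Longrightarrow> f x = f u \<Longrightarrow> x = u"
    and j: "j < k" "j \<noteq> f u"
  shows "\<exists>w. E v w \<and> f w = j \<and> (E u w \<or> (\<exists>a b. f a = j \<and> f b = f u \<and> pentagon v u a b w))"
proof (rule ccontr)
  assume "\<not> ?thesis"
  then have nadj: "\<And>w. E v w \<Longrightarrow> f w = j \<Longrightarrow> \<not> E u w"
    and nopent: "\<And>w a b. f w = j \<Longrightarrow> f a = j \<Longrightarrow> f b = f u \<Longrightarrow> E v w \<Longrightarrow> \<not> pentagon v u a b w"
    by blast+
  note e = hole_edge[OF h]
  define i where "i = f u"
  have iu: "f u = i" by (simp add: i_def)
  have fv: "f v = k" and ik: "i < k"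
    using h hole_nbr_less[OF h u] by (auto simp: hole_def i_def)
  define A where "A = {a. E u a \<and> f a = j}"
  define B where "B = {b. f b = i \<and> b \<noteq> u \<and> (\<exists>a\<in>A. E a b)}"
  define C where "C = {c. f c = j \<and> (\<exists>b\<in>B. E b c)}"
  have A_far: "\<not> E v a" if "a \<in> A" for a
    using nadj that unfolding A_def by blast
  have B_far: "\<not> E v b" if "b \<in> B" for b
    using that uniq unfolding B_def i_def by blast
  have C_far: "\<not> E v c" if c: "c \<in> C" for c
  proof
    assume vc: "E v c"
    obtain a b where ab: "f c = j" "E b c" "f b = i" "b \<noteq> u" "E a b" "a \<in> A"
      using c unfolding C_def B_def by blast
    then have bB: "b \<in> B" unfolding B_def by blast
    have "pentagon v u a b c"
      unfolding pentagon_def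
    proof (intro conjI)
      show "\<not> E c u" using nadj[of c] vc ab edge_sym by blast
    qed (use u ab vc A_far B_far[OF bB] e[of a c] e[of u b] edge_sym in
        \<open>auto simp: A_def i_def edge_commute\<close>)
    then show False using nopent[of c a b] vc ab by (auto simp: A_def i_def)
  qed
  \<comment> \<open>A new vertex \<open>d\<close> would close an induced path \<open>a b c d\<close> that misses \<open>v\<close>.\<close>
  have D: "d \<in> B \<or> d = u" if cd: "c \<in> C" "E c d" "f d = i" for c d
  proof (rule ccontr)
    assume nd: "\<not> (d \<in> B \<or> d = u)"
    obtain b where b: "f c = j" "b \<in> B" "E b c"
      using cd unfolding C_def by blast
    then obtain a where a: "f b = i" "b \<noteq> u" "E a b" "a \<in> A"
      unfolding B_def by blast
    note ab = a b
    have "\<not> E a d" using nd ab that unfolding B_def by blast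
    moreover have "\<not> E a c" "\<not> E b d" using e[of a c] e[of b d] ab that by (auto simp: A_def)
    moreover have "v \<in> V" using u edge_in by blast
    moreover have "\<not> E v d" using uniq that nd by (auto simp: i_def)
    ultimately show False
      using dominating_P4[of a b c d v] ab that A_far B_far C_far by blast
  qed
  \<comment> \<open>\<open>K\<close> is the whole Kempe chain of \<open>u\<close>, and \<open>g\<close> exchanges its colours.\<close>
  define K where "K = insert u (A \<union> B \<union> C)"
  define g where "g = (\<lambda>x. if x \<in> K then (if f x = i then j else i) else if x = v then i else f x)"
  have Kij: "f x = i \<or> f x = j" if "x \<in> K" for x
    using that unfolding K_def A_def B_def C_def by (auto simp: i_def)
  have closed: "y \<in> K" if xy: "x \<in> K" "E x y" "f y = i \<or> f y = j" for x y
  proof -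
    have "f x \<noteq> f y" by (rule e[OF xy(2)])
    then consider "f x = i" "f y = j" | "f x = j" "f y = i" using Kij[OF xy(1)] xy by auto
    then show ?thesis
    proof cases
      case 1
      then have "x = u \<or> x \<in> B"
        using xy j unfolding K_def A_def C_def by (auto simp: i_def)
      then show ?thesis using 1 xy unfolding K_def A_def C_def by blast
    next
      case 2
      then have "x \<in> A \<or> x \<in> C"
        using xy j unfolding K_def B_def by (auto simp: i_def)
      then show ?thesis using 2 xy D unfolding K_def B_def by blast
    qed
  qed
  have vK: "v \<notin> K" using Kij[of v] fv ik j by auto
  have v_far: "\<not> E v x" if "x \<in> K" "x \<noteq> u" for x
    using that A_far B_far C_far unfolding K_def by blast
  have "g x \<noteq> g y" if xy: "E x y" for x y
  proof -
    have *: "g x \<noteq> g y" if "E x y" "x \<in> K" for x y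
    proof (cases "y \<in> K")
      case True
      then show ?thesis using that Kij[of x] Kij[of y] e[of x y] j by (auto simp: g_def i_def)
    next
      case False
      show ?thesis
      proof (cases "y = v")
        case True
        then have "x = u" using v_far that edge_sym by blast
        then show ?thesis using True False that j by (auto simp: g_def i_def)
      next
        case False2: False
        have "f y \<noteq> i" "f y \<noteq> j" using closed that False by blast+
        then show ?thesis using False False2 that j by (auto simp: g_def i_def)
      qed
    qed
    show ?thesis
    proof (cases "x \<in> K \<or> y \<in> K")
      case True
      then show ?thesis using * xy edge_sym by metis
    next
      case False
      have "f y \<noteq> i" if "x = v" using uniq xy that False by (auto simp: K_def i_def)
      moreover have "f x \<noteq> i" if "y = v" using uniq xy that False edge_sym by (auto simp: K_def i_def)
      ultimately show ?thesis using False e[OF xy] edge_irrefl xy by (auto simp: g_def)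
    qed
  qed
  then have "proper g" by (auto simp: proper_def)
  from proper_large[OF this] obtain x where x: "x \<in> V" "k \<le> g x" by blast
  then show False using ik j hole_less[OF h, of x] by (auto simp: g_def split: if_splits)
qed

text \<open>
  The inner vertex \<open>b\<close> of a chain of length three has the colour of \<open>u\<close> and sees the colour \<open>j\<close>
  twice; where this is excluded, the chain is a single edge.
\<close>

lemma kempe_adjacent:
  assumes h: "hole v f" and u: "E v u" "\<And>x. E v x \<Longrightarrow> f x = f u \<Longrightarrow> x = u"
    and j: "j < k" "j \<noteq> f u" and x: "E v x" "f x = j" "\<not> twice f v j"
    and once: "\<And>b. b \<in> V \<Longrightarrow> f b = f u \<Longrightarrow> b \<noteq> u \<Longrightarrow> \<not> twice f b j"
  shows "E u x"
proof (rule ccontr)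
  assume n: "\<not> E u x"
  obtain w where w: "E v w" "f w = j" "E u w \<or> (\<exists>a b. f a = j \<and> f b = f u \<and> pentagon v u a b w)"
    using kempe[OF h u j] by blast
  have "w = x" using not_twiceD[OF x(3)] w x by blast
  then obtain a b where ab: "f a = j" "f b = f u" "pentagon v u a b x" using w n by blast
  then have "E b a" "E b x" "a \<noteq> x" "b \<noteq> u"
    using n by (auto simp: pentagon_def edge_commute)
  then show False using once[of b] ab x by (auto simp: twice_def intro: edge_in)
qed

section \<open>Pentagons containing two entire colour classes\<close>

lemma twice_cong: "(\<And>x. f x = j \<longleftrightarrow> g x = j) \<Longrightarrow> twice f x j \<longleftrightarrow> twice g x j"
  by (simp add: twice_def)

lemma pentagon_distinct: "pentagon a b c d e \<Longrightarrow> distinct [a, b, c, d, e]"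
  using edge_irrefl by (auto simp: pentagon_def dest: edge_sym)

lemma pentagon_in: "pentagon a b c d e \<Longrightarrow> {a, b, c, d, e} \<subseteq> V"
  by (auto simp: pentagon_def intro: edge_in)

abbreviation others :: "nat \<Rightarrow> nat \<Rightarrow> nat set" where
  "others p q \<equiv> {..<k} - {p, q}"

text \<open>
  The case of \<open>k - 2\<close> colours: three edges are left for \<open>S\<close> and for second neighbours.
\<close>

lemma others_budget:
  assumes pq: "p < k" "q < k" "p \<noteq> q" and x: "x \<in> V"
    and S: "\<And>y. y \<in> S \<Longrightarrow> E x y \<and> f y \<in> {p, q, k}"
    and sees: "\<And>j. j \<in> others p q \<Longrightarrow> \<exists>y. E x y \<and> f y = j"
  shows "card S + card {j \<in> others p q. twice f x j} \<le> 3"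
proof -
  have "card (others p q) = k - 2" using pq by (simp add: card_Diff_subset)
  moreover have "card S + card (others p q) + card {j \<in> others p q. twice f x j} \<le> k + 1"
    using S sees by (intro degree_budget x) force+
  ultimately show ?thesis using k_ge by linarith
qed

text \<open>
  A vertex \<open>x\<close> adjacent to an entire pentagon is, as the only neighbour of the hole with its
  colour, itself a possible hole and sees all other colours.  With five neighbours spent on two
  colours and the hole, it has at least \<open>k + 2\<close> neighbours.
\<close>

lemma no_hub:
  assumes h: "hole v f" and C: "pentagon v b c d e" and pq: "p < k" "q < k" "p \<noteq> q"
    and col: "{f b, f c, f d, f e} \<subseteq> {p, q}"
    and j: "j \<in> others p q" and x: "f x = j" "\<not> twice f v j"
    and hub: "E x v" "E x b" "E x c" "E x d" "E x e"
  shows False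
proof -
  let ?S = "{v, b, c, d, e}"
  have "card ?S + card (others p q - {j}) + card {l \<in> others p q - {j}. twice f x l} \<le> k + 1"
  proof (rule degree_budget)
    show "x \<in> V" using hub edge_in by blast
    have "f v = k" using h by (simp add: hole_def)
    then show "E x y \<and> f y \<notin> others p q - {j}" if "y \<in> ?S" for y
      using that hub col by auto
    show "\<exists>y. E x y \<and> f y = l" if "l \<in> others p q - {j}" for l
      using that x hub edge_sym by (intro unique_sees[OF h]) (auto simp: twice_def)
  qed simp
  moreover have "card ?S = 5" using pentagon_distinct[OF C] by simp
  moreover have "card (others p q - {j}) = k - 3"
    using pq j by (simp add: card_Diff_subset)
  ultimately show False using k_ge by linarith
qed

text \<open>
  A pentagon with the hole at \<open>a\<close> whose other vertices form two entire colour classes.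
  Such a colouring can be rotated: the hole moves on to \<open>b\<close>, and the roles of \<open>p\<close> and \<open>q\<close>
  are interchanged.
\<close>

definition ring :: "'a \<Rightarrow> 'a \<Rightarrow> 'a \<Rightarrow> 'a \<Rightarrow> 'a \<Rightarrow> ('a \<Rightarrow> nat) \<Rightarrow> nat \<Rightarrow> nat \<Rightarrow> bool" where
  "ring a b c d e f p q \<longleftrightarrow> pentagon a b c d e \<and> hole a f \<and> p < k \<and> q < k \<and> p \<noteq> q \<and>
     {x \<in> V. f x = p} = {b, d} \<and> {x \<in> V. f x = q} = {c, e}"

lemma ring_rotate:
  assumes "ring a b c d e f p q"
  shows "ring b c d e a (f(a := p, b := k)) q p"
proof -
  have P: "pentagon a b c d e" and h: "hole a f" and pq: "p < k" "q < k" "p \<noteq> q"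
    and cp: "{x \<in> V. f x = p} = {b, d}" and cq: "{x \<in> V. f x = q} = {c, e}"
    using assms by (auto simp: ring_def)
  have fb: "f b = p" and fa: "f a = k" using cp h by (auto simp: hole_def)
  have ab: "E a b" "\<not> E a d" using P by (auto simp: pentagon_def edge_commute)
  have "hole b (f(a := f b, b := k))"
    using ab cp fb by (intro hole_shift[OF h]) (auto intro: edge_in2)
  moreover have "{x \<in> V. (f(a := p, b := k)) x = q} = {x \<in> V. f x = q}"
    using pq fa fb by auto
  moreover have "{x \<in> V. (f(a := p, b := k)) x = p} = insert a ({x \<in> V. f x = p} - {b})"
    using pq fa pentagon_in[OF P] pentagon_distinct[OF P] by auto
  then have "{x \<in> V. (f(a := p, b := k)) x = p} = {d, a}"
    using pentagon_distinct[OF P] unfolding cp by auto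
  ultimately show ?thesis
    using pq fb cq pentagon_rotate[OF P] by (simp add: ring_def)
qed

lemma ring_colours:
  assumes "ring a b c d e f p q" "j \<in> others p q"
  shows "(f(a := p, b := k)) x = j \<longleftrightarrow> f x = j"
proof -
  have "f a = k" "f b = p" using assms by (auto simp: ring_def hole_def)
  then show ?thesis using assms by auto
qed

lemma ring_local:
  assumes R: "ring a b c d e f p q"
  shows "card {j \<in> others p q. twice f a j} \<le> 1"
    and "\<lbrakk>j \<in> others p q; \<not> twice f a j; \<not> twice f d j; E a x; f x = j\<rbrakk> \<Longrightarrow> E b x"
proof -
  have P: "pentagon a b c d e" and h: "hole a f" and pq: "p < k" "q < k" "p \<noteq> q"
    and cp: "{x \<in> V. f x = p} = {b, d}" and cq: "{x \<in> V. f x = q} = {c, e}"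
    using R by (auto simp: ring_def)
  have fb: "f b = p" using cp by auto
  have "card {b, e} + card {j \<in> others p q. twice f a j} \<le> 3"
  proof (rule others_budget[OF pq])
    show "a \<in> V" using pentagon_in[OF P] by simp
    have "f b = p" "f e = q" using cp cq by auto
    then show "E a y \<and> f y \<in> {p, q, k}" if "y \<in> {b, e}" for y
      using P that by (auto simp: pentagon_def edge_commute)
    show "\<exists>y. E a y \<and> f y = j" if "j \<in> others p q" for j
      using hole_sees[OF h] that by simp
  qed
  then show "card {j \<in> others p q. twice f a j} \<le> 1"
    using pentagon_distinct[OF P] by simp
  show "E b x" if "j \<in> others p q" "\<not> twice f a j" "\<not> twice f d j" "E a x" "f x = j"
  proof (rule kempe_adjacent[OF h])
    have *: "y = b \<or> y = d" if "y \<in> V" "f y = p" for y using cp that by blast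
    show "E a b" using P by (simp add: pentagon_def)
    show "y = b" if "E a y" "f y = f b" for y
      using *[of y] that fb P edge_in2[OF that(1)] by (auto simp: pentagon_def edge_commute)
    show "\<not> twice f z j" if "z \<in> V" "f z = f b" "z \<noteq> b" for z
      using *[of z] that \<open>\<not> twice f d j\<close> fb by auto
  qed (use that fb in auto)
qed

text \<open>
  Each of the five vertices can be the hole, so each sees at most one further colour twice.
  There are \<open>k - 2 \<ge> 6\<close> further colours, so some colour is seen twice by none of the five, and
  rotation carries a neighbour of that colour around the whole pentagon.
\<close>

lemma no_ring: "\<not> ring a b c d e f p q"
proof
  assume R0: "ring a b c d e f p q"
  define f1 where "f1 = f(a := p, b := k)"
  define f2 where "f2 = f1(b := q, c := k)"
  define f3 where "f3 = f2(c := p, d := k)"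
  define f4 where "f4 = f3(d := q, e := k)"
  have R1: "ring b c d e a f1 q p" using ring_rotate[OF R0] by (simp add: f1_def)
  have R2: "ring c d e a b f2 p q" using ring_rotate[OF R1] by (simp add: f2_def)
  have R3: "ring d e a b c f3 q p" using ring_rotate[OF R2] by (simp add: f3_def)
  have R4: "ring e a b c d f4 p q" using ring_rotate[OF R3] by (simp add: f4_def)
  have oc: "others q p = others p q" by blast
  have P: "pentagon a b c d e" and h: "hole a f" and pq: "p < k" "q < k" "p \<noteq> q"
    and cp: "{x \<in> V. f x = p} = {b, d}" and cq: "{x \<in> V. f x = q} = {c, e}"
    using R0 by (auto simp: ring_def)
  have c1: "f1 x = j \<longleftrightarrow> f x = j" if "j \<in> others p q" for x j
    unfolding f1_def using ring_colours[OF R0] that by blast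
  have c2: "f2 x = j \<longleftrightarrow> f x = j" if "j \<in> others p q" for x j
    using ring_colours[OF R1] that c1 oc unfolding f2_def by blast
  have c3: "f3 x = j \<longleftrightarrow> f x = j" if "j \<in> others p q" for x j
    using ring_colours[OF R2] that c2 unfolding f3_def by blast
  have c4: "f4 x = j \<longleftrightarrow> f x = j" if "j \<in> others p q" for x j
    using ring_colours[OF R3] that c3 oc unfolding f4_def by blast
  define B where "B x = {j \<in> others p q. twice f x j}" for x
  have tw: "twice f1 x j = twice f x j" "twice f2 x j = twice f x j"
    "twice f3 x j = twice f x j" "twice f4 x j = twice f x j" if "j \<in> others p q" for x j
    by (rule twice_cong, rule c1[OF that] c2[OF that] c3[OF that] c4[OF that])+
  have "card (B a) \<le> 1" using ring_local(1)[OF R0] by (simp add: B_def)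
  moreover have "card (B b) \<le> 1" using ring_local(1)[OF R1] tw(1) oc
    by (simp add: B_def cong: conj_cong)
  moreover have "card (B c) \<le> 1" using ring_local(1)[OF R2] tw(2)
    by (simp add: B_def cong: conj_cong)
  moreover have "card (B d) \<le> 1" using ring_local(1)[OF R3] tw(3) oc
    by (simp add: B_def cong: conj_cong)
  moreover have "card (B e) \<le> 1" using ring_local(1)[OF R4] tw(4)
    by (simp add: B_def cong: conj_cong)
  ultimately have "card (B a \<union> B b \<union> B c \<union> B d \<union> B e) \<le> 5"
    using card_Un_le[of "B a" "B b"] card_Un_le[of "B a \<union> B b" "B c"]
      card_Un_le[of "B a \<union> B b \<union> B c" "B d"] card_Un_le[of "B a \<union> B b \<union> B c \<union> B d" "B e"]
    by linarith
  moreover have "card (others p q) = k - 2" using pq by (simp add: card_Diff_subset)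
  ultimately have "\<not> others p q \<subseteq> B a \<union> B b \<union> B c \<union> B d \<union> B e"
    using card_mono[of "B a \<union> B b \<union> B c \<union> B d \<union> B e" "others p q"] k_ge
    by (auto simp: B_def)
  then obtain j where j: "j \<in> others p q" "\<not> twice f a j" "\<not> twice f b j" "\<not> twice f c j"
    "\<not> twice f d j" "\<not> twice f e j" by (auto simp: B_def)
  then have jo: "j \<in> others q p" by blast
  obtain x where x: "E a x" "f x = j" using hole_sees[OF h, of j] j by auto
  have "E b x" using ring_local(2)[OF R0] j x by blast
  moreover from this have "E c x" using ring_local(2)[OF R1 jo, of x] j(2-) x(2) by (simp add: tw[OF j(1)] c1[OF j(1)])
  moreover from this have "E d x" using ring_local(2)[OF R2 j(1), of x] j(2-) x(2) by (simp add: tw[OF j(1)] c2[OF j(1)])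
  moreover from this have "E e x" using ring_local(2)[OF R3 jo, of x] j(2-) x(2) by (simp add: tw[OF j(1)] c3[OF j(1)])
  moreover have "{f b, f c, f d, f e} \<subseteq> {p, q}" using cp cq by auto
  ultimately show False using no_hub[OF h P pq _ j(1) x(2) j(2)] x edge_sym by blast
qed

section \<open>Unique neighbours of the hole\<close>

text \<open>
  The situation to be refuted: a pentagon obtained from non-adjacent unique neighbours \<open>u\<close>,
  \<open>w\<close> of the hole \<open>v\<close> and a Kempe chain \<open>u a b w\<close>.  In contrast to a ring, the two
  colour classes may have further vertices.
\<close>

definition config :: "'a \<Rightarrow> 'a \<Rightarrow> 'a \<Rightarrow> 'a \<Rightarrow> 'a \<Rightarrow> ('a \<Rightarrow> nat) \<Rightarrow> nat \<Rightarrow> nat \<Rightarrow> bool" where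
  "config v u a b w f p q \<longleftrightarrow> pentagon v u a b w \<and> hole v f \<and> p \<noteq> q \<and>
     f u = p \<and> f a = q \<and> f b = p \<and> f w = q \<and>
     (\<forall>x. E v x \<and> f x = p \<longrightarrow> x = u) \<and> (\<forall>x. E v x \<and> f x = q \<longrightarrow> x = w)"

lemma config_reflect: "config v u a b w f p q \<Longrightarrow> config v w b a u f q p"
  using pentagon_reflect by (auto simp: config_def)

lemma config_shift:
  assumes "config v u a b w f p q" "\<And>x. E u x \<Longrightarrow> f x = q \<Longrightarrow> x = a"
  shows "config u v w b a (f(v := p, u := k)) p q"
proof -
  have C: "pentagon v u a b w" "hole v f" "p \<noteq> q" "f u = p" "f a = q" "f b = p" "f w = q"
    and un: "\<And>x. E v x \<Longrightarrow> f x = p \<Longrightarrow> x = u"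
    using assms(1) by (auto simp: config_def)
  have fv: "f v = k" using C(2) by (simp add: hole_def)
  have uv: "E v u" "E v w" using C(1) by (auto simp: pentagon_def edge_commute)
  have pq: "p < k" "q < k"
    using hole_nbr_less[OF C(2)] uv C(4,7) by metis+
  have d: "distinct [v, u, a, b, w]" using pentagon_distinct C(1) by blast
  have "pentagon u v w b a"
    using pentagon_reflect[OF pentagon_rotate[OF C(1)]] by simp
  moreover have "hole u (f(v := p, u := k))"
    using hole_shift[OF C(2) uv(1)] un C(4) by simp
  moreover have "x = v" if "E u x" "(f(v := p, u := k)) x = p" for x
    using that hole_edge[OF C(2) that(1)] C(4) pq by (auto split: if_splits)
  moreover have "x = a" if "E u x" "(f(v := p, u := k)) x = q" for x
    using that assms(2) C(3) pq by (auto split: if_splits)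
  ultimately show ?thesis using C d by (auto simp: config_def)
qed

context
  fixes v u a b w f p q
  assumes config: "config v u a b w f p q"
begin

lemma config_facts:
  shows "pentagon v u a b w" "hole v f" "p < k" "q < k" "p \<noteq> q"
    "f u = p" "f a = q" "f b = p" "f w = q"
    "E v u" "E u a" "E a b" "E b w" "E v w" "distinct [v, u, a, b, w]" "v \<in> V" "u \<in> V" "a \<in> V" "b \<in> V" "w \<in> V"
proof -
  show C: "pentagon v u a b w" "hole v f" "p \<noteq> q" "f u = p" "f a = q" "f b = p" "f w = q"
    using config by (auto simp: config_def)
  show uv: "E v u" "E u a" "E a b" "E b w" "E v w"
    using C(1) by (auto simp: pentagon_def edge_commute)
  show "p < k" "q < k"
    using hole_nbr_less[OF C(2)] uv C(4,7) by metis+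
  show "distinct [v, u, a, b, w]" using pentagon_distinct C(1) by blast
  show "v \<in> V" "u \<in> V" "a \<in> V" "b \<in> V" "w \<in> V" using pentagon_in[OF C(1)] by auto
qed

lemma config_hole: "f v = k"
  using config by (simp add: config_def hole_def)

lemma config_unique: "E v x \<Longrightarrow> f x = p \<Longrightarrow> x = u" "E v x \<Longrightarrow> f x = q \<Longrightarrow> x = w"
  using config by (auto simp: config_def)

lemma config_sees:
  assumes "j \<in> others p q"
  shows "\<exists>x. E v x \<and> f x = j" "\<exists>x. E u x \<and> f x = j" "\<exists>x. E w x \<and> f x = j"
proof -
  have j: "j < k" "j \<noteq> f u" "j \<noteq> f w" using assms config_facts(6,9) by auto
  show "\<exists>x. E v x \<and> f x = j" using hole_sees[OF config_facts(2) j(1)] .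
  show "\<exists>x. E u x \<and> f x = j"
    using unique_sees[OF config_facts(2,10) _ j(1,2)] config_unique(1) config_facts(6) by simp
  show "\<exists>x. E w x \<and> f x = j"
    using unique_sees[OF config_facts(2,14) _ j(1,3)] config_unique(2) config_facts(9) by simp
qed

lemma config_near:
  assumes j: "j \<in> others p q" and x: "E v x" "f x = j" "\<not> twice f v j"
    and once: "\<And>z. z \<in> V \<Longrightarrow> f z = p \<Longrightarrow> z \<noteq> u \<Longrightarrow> \<not> twice f z j"
  shows "E u x"
proof (rule kempe_adjacent[OF config_facts(2,10) _ _ _ x])
  show "j < k" "j \<noteq> f u" using j config_facts(6) by auto
qed (use config_unique(1) once config_facts(6) in auto)

text \<open>
  A further vertex of colour \<open>p\<close> misses \<open>v\<close>, \<open>u\<close> and \<open>b\<close>, so domination forces the edges to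
  \<open>a\<close> and \<open>w\<close>: it is interchangeable with \<open>b\<close>.
\<close>

lemma config_extra:
  assumes "x \<in> V" "f x = p" "x \<noteq> u" "x \<noteq> b"
  shows "E x a" "E x w" "\<not> E x v" "\<not> E x u" "\<not> E x b" "pentagon v u a x w"
proof -
  show n: "\<not> E x v" "\<not> E x u" "\<not> E x b"
    using assms config_unique(1)[of x] hole_edge[OF config_facts(2)] config_facts edge_sym by metis+
  show m: "E x a" "E x w"
    using pentagon_two_nbrs[OF config_facts(1) assms(1)] n by blast+
  show "pentagon v u a x w"
    using n m config_facts(1) by (auto simp: pentagon_def edge_commute)
qed

lemma config_change:
  assumes x: "x \<in> V" "f x = p" "x \<noteq> u" "x \<noteq> b"
  shows "config v u a x w f p q"
  using config config_extra(6)[OF x] x(2) by (simp add: config_def)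

lemma config_budget:
  assumes "x \<in> V" "\<forall>y\<in>S. E x y" "f ` S \<subseteq> {p, q, k}"
    and "\<And>j. j \<in> others p q \<Longrightarrow> \<exists>y. E x y \<and> f y = j"
  shows "card S + card {j \<in> others p q. twice f x j} \<le> 3"
proof (rule others_budget[OF config_facts(3-5) assms(1)])
  show "E x y \<and> f y \<in> {p, q, k}" if "y \<in> S" for y using assms(2,3) that by blast
qed (rule assms(4))

lemmas config_facts_sym = config_facts(10-14)[THEN edge_sym]

text \<open>
  Further vertices of colour \<open>p\<close> are neighbours of \<open>w\<close>, which has room for only one of them.
\<close>

lemma config_extra_unique:
  assumes x: "x \<in> V" "f x = p" "x \<noteq> u" "x \<noteq> b" and y: "y \<in> V" "f y = p" "y \<noteq> u" "y \<noteq> b"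
  shows "x = y"
proof (rule ccontr)
  assume "x \<noteq> y"
  have "card {v, b, x, y} + card {j \<in> others p q. twice f w j} \<le> 3"
    using config_extra(2)[OF x] config_extra(2)[OF y]
    by (intro config_budget config_sees(3))
      (simp_all add: config_facts config_facts_sym config_hole x y edge_commute[of w])
  moreover have "card {v, b, x, y} = 4"
  proof -
    have "x \<noteq> v" "y \<noteq> v" using x(2) y(2) config_hole config_facts(3) by auto
    then show ?thesis using \<open>x \<noteq> y\<close> x(4) y(4) config_facts(15) by auto
  qed
  ultimately show False by simp
qed

lemma config_class:
  assumes x: "x \<in> V" "f x = p" "x \<noteq> u" "x \<noteq> b"
  shows "{y \<in> V. f y = p} = {u, b, x}"
proof (intro set_eqI iffI)
  fix y assume "y \<in> {y \<in> V. f y = p}"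
  then show "y \<in> {u, b, x}" using config_extra_unique[OF x, of y] by blast
next
  fix y assume "y \<in> {u, b, x}"
  then show "y \<in> {y \<in> V. f y = p}" using x(1,2) config_facts(6,8,17,19) by blast
qed

text \<open>
  A colour not seen by \<open>b\<close> can be used to remove \<open>b\<close> from the class \<open>p\<close>, with \<open>x\<close> taking over
  its place on the pentagon.
\<close>

lemma config_recolour:
  assumes x: "x \<in> V" "f x = p" "x \<noteq> u" "x \<noteq> b"
    and j: "j \<in> others p q" "\<And>y. E b y \<Longrightarrow> f y \<noteq> j"
  shows "config v u a x w (f(b := j)) p q"
    "{y \<in> V. (f(b := j)) y = p} = {y \<in> V. f y = p} - {b}"
    "{y \<in> V. (f(b := j)) y = q} = {y \<in> V. f y = q}"
proof -
  have jj: "j < k" "p \<noteq> j" "q \<noteq> j" using j(1) by auto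
  have "b \<noteq> v" using config_facts(15) by auto
  then have "hole v (f(b := j))"
    by (rule hole_update[OF config_facts(2) _ jj(1) j(2)])
  then show "config v u a x w (f(b := j)) p q"
    using config_change[OF x] config_facts(15) jj x(4) by (auto simp: config_def)
  show "{y \<in> V. (f(b := j)) y = p} = {y \<in> V. f y = p} - {b}"
    "{y \<in> V. (f(b := j)) y = q} = {y \<in> V. f y = q}"
    using jj config_facts(5,8) by auto
qed

end

text \<open>
  With three vertices of colour \<open>p\<close> and two of colour \<open>q\<close>, recolouring \<open>b\<close> would leave a ring.
\<close>

lemma config_small_class_sees:
  assumes c: "config v u a b w f p q" and cq: "{x \<in> V. f x = q} = {a, w}"
    and cp: "{x \<in> V. f x = p} = {u, b, b'}" "b' \<noteq> b" "b' \<noteq> u" and j: "j \<in> others p q"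
  shows "\<exists>x. E b x \<and> f x = j"
proof (rule ccontr)
  assume n: "\<not> ?thesis"
  have b': "b' \<in> V" "f b' = p" "b' \<noteq> u" "b' \<noteq> b" using cp by auto
  note r = config_recolour[OF c b' j]
  have "ring v u a b' w (f(b := j)) p q"
    unfolding ring_def
    using n r config_facts[OF r(1)] config_facts[OF c] cp cq by auto
  then show False using no_ring by blast
qed

text \<open>
  Let \<open>x\<close>, \<open>y\<close> be the neighbours of \<open>v\<close>, \<open>u\<close> with colour \<open>j\<close>.  Kempe chains in \<open>q\<close> and \<open>j\<close> put
  \<open>w\<close> next to \<open>x\<close> and \<open>a\<close> next to \<open>y\<close>, so by domination \<open>j\<close> occurs nowhere else.  If
  \<open>x = y\<close>, this vertex is also the neighbour of \<open>b\<close> of colour \<open>j\<close> and hence a hub.  Otherwise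
  the Kempe chain from \<open>u\<close> to \<open>x\<close> passes through \<open>b\<close> or \<open>b'\<close>, and domination of the pentagon
  that it forms with \<open>v\<close> makes \<open>x\<close> and \<open>y\<close> neighbours of both.
\<close>

lemma config_small_class_twice:
  assumes c: "config v u a b w f p q" and cq: "{x \<in> V. f x = q} = {a, w}"
    and cp: "{x \<in> V. f x = p} = {u, b, b'}" "b' \<noteq> b" "b' \<noteq> u"
    and j: "j \<in> others p q" "\<not> twice f v j" "\<not> twice f u j" "\<not> twice f a j" "\<not> twice f w j"
  shows "twice f b j"
proof -
  note F = config_facts[OF c]
  have b': "b' \<in> V" "f b' = p" "b' \<noteq> u" "b' \<noteq> b" using cp by auto
  have clq: "x = a \<or> x = w" if "x \<in> V" "f x = q" for x using cq that by blast
  have clp: "x = u \<or> x = b \<or> x = b'" if "x \<in> V" "f x = p" for x using cp that by blast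
  have nonadj: "\<not> E u w" "\<not> E v a" "\<not> E v b"
    using F(1) by (auto simp: pentagon_def edge_commute)
  have jj: "j < k" "j \<noteq> p" "j \<noteq> q" using j by auto
  obtain x where x: "E v x" "f x = j" using config_sees[OF c j(1)] by blast
  obtain y where y: "E u y" "f y = j" using config_sees[OF c j(1)] by blast
  have ux: "x = y" if "E u x" using not_twiceD[OF j(3)] x y that by blast
  have wx: "E w x"
    using config_near[OF config_reflect[OF c] _ x j(2)] j clq by blast
  let ?g = "f(v := p, u := k)"
  have c': "config u v w b a ?g p q"
    using clq nonadj by (intro config_shift[OF c]) (auto intro: edge_in2)
  have g: "?g z = j \<longleftrightarrow> f z = j" for z using jj F(6) config_hole[OF c] by auto
  have ay: "E a y"
  proof (rule config_near[OF config_reflect[OF c']])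
    show "\<not> twice ?g u j" using j(3) twice_cong[of ?g j f, OF g] by blast
    show "\<not> twice ?g z j" if "z \<in> V" "?g z = q" "z \<noteq> a" for z
    proof -
      have "f z = q" using that F(3-5) by (auto split: if_splits)
      then show ?thesis using clq that j(5) twice_cong[of ?g j f, OF g] by blast
    qed
    show "j \<in> others q p" using j by blast
  qed (use g y in simp_all)
  have cls: "t = x \<or> t = y" if t: "t \<in> V" "f t = j" for t
  proof (rule ccontr)
    assume n: "\<not> ?thesis"
    have "\<not> E v t" "\<not> E w t" using n t x wx not_twiceD[OF j(2)] not_twiceD[OF j(5)] by blast+
    moreover have "\<not> E u t" "\<not> E a t" using n t y ay not_twiceD[OF j(3)] not_twiceD[OF j(4)] by blast+
    ultimately show False using pentagon_two_nbrs[OF F(1) t(1)] edge_sym by blast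
  qed
  have xy: "x \<noteq> y"
  proof
    assume "x = y"
    obtain t where t: "E b t" "f t = j" using config_small_class_sees[OF c cq cp j(1)] by blast
    then have "E x b" using cls[of t] edge_in2 edge_sym \<open>x = y\<close> by blast
    then show False
      using no_hub[OF F(2,1,3,4,5) _ j(1) x(2) j(2)] F wx ay x y \<open>x = y\<close> edge_sym by blast
  qed
  obtain z where z: "E v z" "f z = j" "E u z \<or> (\<exists>c d. f c = j \<and> f d = f u \<and> pentagon v u c d z)"
    using kempe[OF F(2,10), of j] config_unique[OF c] F jj by metis
  have "z = x" using not_twiceD[OF j(2)] z x by blast
  then obtain y' d where d: "f y' = j" "f d = p" "pentagon v u y' d x"
    using z ux xy F(6) by auto
  have "y' = y" using not_twiceD[OF j(3)] d y by (auto simp: pentagon_def)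
  then have dn: "E d x" "E d y" "d \<noteq> u" "d \<in> V"
    using d pentagon_in[OF d(3)] F(10) by (auto simp: pentagon_def edge_commute)
  show ?thesis
  proof (cases "d = b")
    case True
    then show ?thesis using dn xy x y by (auto simp: twice_def)
  next
    case False
    then have "d = b'" using clp[of d] dn d by blast
    then have "\<not> E b d" using config_extra(5)[OF c b'] edge_sym by blast
    moreover have "\<not> E b v" "\<not> E b u" using nonadj hole_edge[OF F(2), of b u] F edge_sym by auto
    ultimately have "E b x" "E b y"
      using pentagon_two_nbrs[OF d(3), of b] F \<open>y' = y\<close> by blast+
    then show ?thesis using xy x y by (auto simp: twice_def)
  qed
qed

text \<open>
  If \<open>q\<close> had no further vertices, \<open>p\<close> would have exactly one, since there is no ring.  Then
  \<open>a\<close> and \<open>w\<close> see none of the \<open>k - 2 > 3\<close> other colours twice, and \<open>v\<close>, \<open>u\<close>, \<open>b\<close> at most one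
  each; but by \<open>config_small_class_twice\<close> each of these colours is seen twice by one of
  \<open>v\<close>, \<open>u\<close>, \<open>b\<close>.
\<close>

lemma config_class_larger:
  assumes c: "config v u a b w f p q"
  shows "{x \<in> V. f x = q} \<noteq> {a, w}"
proof
  assume cq: "{x \<in> V. f x = q} = {a, w}"
  note F = config_facts[OF c]
  have clq: "x = a \<or> x = w" if "x \<in> V" "f x = q" for x using cq that by blast
  have "{x \<in> V. f x = p} \<noteq> {u, b}"
    using no_ring[of v u a b w f p q] F cq by (auto simp: ring_def)
  then obtain b' where b': "b' \<in> V" "f b' = p" "b' \<noteq> u" "b' \<noteq> b"
    using F by auto
  have cp: "{x \<in> V. f x = p} = {u, b, b'}"
    using config_class[OF c b'] .
  have nonadj: "\<not> E u w" using F(1) by (auto simp: pentagon_def edge_commute)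
  note X = config_extra[OF c b']
  let ?g = "f(v := p, u := k)"
  have c': "config u v w b a ?g p q"
    using clq nonadj by (intro config_shift[OF c]) (auto intro: edge_in2)
  have a_sees: "\<exists>x. E a x \<and> f x = j" if j: "j \<in> others p q" for j
  proof -
    obtain x where "E a x" "?g x = j" using config_sees(3)[OF c' j] by blast
    then show ?thesis using j by (auto split: if_splits)
  qed
  define B where "B x = {j \<in> others p q. twice f x j}" for x
  note Fs = F config_facts_sym[OF c] config_hole[OF c] b' X X(1,2)[THEN edge_sym]
  have b_sees: "\<exists>x. E b x \<and> f x = j" if "j \<in> others p q" for j
    using config_small_class_sees[OF c cq cp b'(4,3) that] .
  have "card {u, w} + card (B v) \<le> 3" unfolding B_def
    by (intro config_budget[OF c] config_sees(1)[OF c]) (simp_all add: Fs)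
  moreover have "card {v, a} + card (B u) \<le> 3" unfolding B_def
    by (intro config_budget[OF c] config_sees(2)[OF c]) (simp_all add: Fs)
  moreover have "card {a, w} + card (B b) \<le> 3" unfolding B_def
    by (intro config_budget[OF c] b_sees) (simp_all add: Fs)
  moreover have "card {u, b, b'} + card (B a) \<le> 3" unfolding B_def
    by (intro config_budget[OF c] a_sees) (simp_all add: Fs)
  moreover have "card {v, b, b'} + card (B w) \<le> 3" unfolding B_def
    by (intro config_budget[OF c] config_sees(3)[OF c]) (simp_all add: Fs)
  moreover have "b' \<noteq> v" using b'(2) config_hole[OF c] F(3) by auto
  ultimately have card: "card (B v) \<le> 1" "card (B u) \<le> 1" "card (B b) \<le> 1" "card (B a) = 0" "card (B w) = 0"
    using F(15) b'(3,4) by (auto split: if_splits)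
  have fin: "finite (B x)" for x by (simp add: B_def)
  have "others p q \<subseteq> B v \<union> B u \<union> B b"
  proof
    fix j assume j: "j \<in> others p q"
    have "\<not> twice f a j" "\<not> twice f w j" using card(4,5) fin[of a] fin[of w] j unfolding B_def by auto
    then show "j \<in> B v \<union> B u \<union> B b"
      using config_small_class_twice[OF c cq cp b'(4,3) j] j unfolding B_def by blast
  qed
  then have "card (others p q) \<le> card (B v \<union> B u \<union> B b)"
    using fin by (intro card_mono) auto
  also have "\<dots> \<le> 3"
    using card card_Un_le[of "B v" "B u"] card_Un_le[of "B v \<union> B u" "B b"] by linarith
  also have "card (others p q) = k - 2" using F(3-5) by (simp add: card_Diff_subset)
  finally show False using k_ge by simp
qed

lemma config_sees_inner:
  assumes c: "config v u a b w f p q" and j: "j \<in> others p q"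
  shows "\<exists>x. E b x \<and> f x = j" "\<exists>x. E a x \<and> f x = j"
proof -
  have *: "\<exists>x. E b x \<and> f x = j" if c: "config v u a b w f p q" and j: "j \<in> others p q" for v u a b w p q
  proof (rule ccontr)
    assume n: "\<not> ?thesis"
    note F = config_facts[OF c]
    have "{x \<in> V. f x = p} \<noteq> {u, b}"
      using config_class_larger[OF config_reflect[OF c]] by (simp add: insert_commute)
    then obtain b' where b': "b' \<in> V" "f b' = p" "b' \<noteq> u" "b' \<noteq> b" using F by auto
    have cp: "{x \<in> V. f x = p} = {u, b, b'}"
      using config_class[OF c b'] .
    note r = config_recolour[OF c b' j]
    have "config v u a b' w (f(b := j)) p q" "{x \<in> V. (f(b := j)) x = p} = {b', u}"
      using r n cp b'(4) F(15) by auto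
    then show False using config_class_larger[OF config_reflect] by blast
  qed
  show "\<exists>x. E b x \<and> f x = j" using * c j by blast
  have "j \<in> others q p" using j by blast
  then show "\<exists>x. E a x \<and> f x = j" using * config_reflect[OF c] by blast
qed

text \<open>
  Now both classes have exactly three vertices, \<open>u, b, b'\<close> and \<open>w, a, a'\<close>, where \<open>a, a'\<close> are
  completely joined to \<open>b, b'\<close>.  All six see every other colour exactly once, so a colour \<open>j\<close> not
  seen twice by \<open>v\<close> has just two vertices: \<open>x\<close>, adjacent to \<open>v, u, w\<close>, and \<open>y\<close>, adjacent to
  \<open>a, a', b, b'\<close>.  The classes \<open>{v, b, b'}\<close>, \<open>{u, w, y}\<close> and \<open>{x, a, a'}\<close> then accommodate the
  hole.
\<close>

lemma no_config: "\<not> config v u a b w f p q"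
proof
  assume c: "config v u a b w f p q"
  note F = config_facts[OF c]
  note cr = config_reflect[OF c]
  obtain b' where b': "b' \<in> V" "f b' = p" "b' \<noteq> u" "b' \<noteq> b"
    using config_class_larger[OF cr] F by auto
  obtain a' where a': "a' \<in> V" "f a' = q" "a' \<noteq> w" "a' \<noteq> a"
    using config_class_larger[OF c] F by auto
  have clp: "x = u \<or> x = b \<or> x = b'" if "x \<in> V" "f x = p" for x
    using config_extra_unique[OF c b'] that by blast
  have clq: "x = w \<or> x = a \<or> x = a'" if "x \<in> V" "f x = q" for x
    using config_extra_unique[OF cr a'] that by blast
  note cb = config_change[OF c b']
  note ca = config_reflect[OF config_change[OF cr a']]
  note X = config_extra[OF c b'] and Y = config_extra[OF cr a']
  have a'b': "E a' b'"
    using config_extra(1)[OF config_reflect[OF cb] a'] .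
  have nv: "a' \<noteq> v" "b' \<noteq> v" using a'(2) b'(2) config_hole[OF c] F(3,4) by auto
  have ne0: "a' \<noteq> b'" "a' \<noteq> u" "a' \<noteq> b" "b' \<noteq> w" "b' \<noteq> a"  using a' b' F(5-9) by auto
  note ne = ne0 nv
  note sees = config_sees_inner[OF c] config_sees_inner[OF cb] config_sees_inner[OF ca]
  note Fs = F config_facts_sym[OF c] config_hole[OF c] a' b' X Y a'b' ne
    X(1,2)[THEN edge_sym] Y(1,2)[THEN edge_sym] a'b'[THEN edge_sym]
  have dist: "distinct [v, u, a, b, w, a', b']" using F(15) a' b' ne by auto
  have once: "\<not> twice f x j" if "j \<in> others p q" "card S = 3" "card S + card {j \<in> others p q. twice f x j} \<le> 3"
    for x j S
    using that by auto
  have o: "\<not> twice f u j" "\<not> twice f w j" "\<not> twice f a j" "\<not> twice f a' j" "\<not> twice f b j" "\<not> twice f b' j"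
    if j: "j \<in> others p q" for j
  proof -
    show "\<not> twice f u j"
      by (rule once[OF j _ config_budget[OF c _ _ _ config_sees(2)[OF c]], of "{v, a, a'}"])
        (use dist in \<open>simp_all add: Fs\<close>)
    show "\<not> twice f w j"
      by (rule once[OF j _ config_budget[OF c _ _ _ config_sees(3)[OF c]], of "{v, b, b'}"])
        (use dist in \<open>simp_all add: Fs\<close>)
    show "\<not> twice f a j"
      by (rule once[OF j _ config_budget[OF c _ _ _ sees(2)], of "{u, b, b'}"])
        (use dist in \<open>simp_all add: Fs\<close>)
    show "\<not> twice f a' j"
      by (rule once[OF j _ config_budget[OF c _ _ _ sees(6)], of "{u, b, b'}"])
        (use dist in \<open>simp_all add: Fs\<close>)
    show "\<not> twice f b j"
      by (rule once[OF j _ config_budget[OF c _ _ _ sees(1)], of "{a, w, a'}"])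
        (use dist in \<open>simp_all add: Fs\<close>)
    show "\<not> twice f b' j"
      by (rule once[OF j _ config_budget[OF c _ _ _ sees(3)], of "{a, w, a'}"])
        (use dist in \<open>simp_all add: Fs\<close>)
  qed
  have "card {u, w} + card {j \<in> others p q. twice f v j} \<le> 3"
    by (intro config_budget[OF c] config_sees(1)[OF c]) (simp_all add: Fs)
  then have "card {j \<in> others p q. twice f v j} \<le> 1" using F(15) by simp
  moreover have "card (others p q) = k - 2" using F(3-5) by (simp add: card_Diff_subset)
  ultimately have "\<not> others p q \<subseteq> {j \<in> others p q. twice f v j}"
    using card_mono[of "{j \<in> others p q. twice f v j}" "others p q"] k_ge by auto
  then obtain j where j: "j \<in> others p q" "\<not> twice f v j" by blast
  have jj: "j < k" "j \<noteq> p" "j \<noteq> q" using j by auto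
  obtain x where x: "E v x" "f x = j" using config_sees[OF c j(1)] by blast
  have ux: "E u x"
    using config_near[OF c j(1) x j(2)] clp o[OF j(1)] by blast
  have "j \<in> others q p" using j(1) by blast
  then have wx: "E w x"
    using config_near[OF cr _ x j(2)] clq o[OF j(1)] by blast
  have far: "\<not> E t v" "\<not> E t u" "\<not> E t w" if t: "f t = j" "t \<noteq> x" for t
    using t x ux wx not_twiceD[OF j(2)] not_twiceD[OF o(1)[OF j(1)]] not_twiceD[OF o(2)[OF j(1)]]
      edge_sym by metis+
  have near: "E t a" "E t a'" "E t b" "E t b'" if t: "t \<in> V" "f t = j" "t \<noteq> x" for t
    using far[OF t(2,3)] pentagon_two_nbrs[OF F(1) t(1)]
      pentagon_two_nbrs[OF config_facts(1)[OF ca] t(1)]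
      pentagon_two_nbrs[OF config_facts(1)[OF cb] t(1)] by blast+
  obtain s t where st: "E a s" "f s = j" "E b t" "f t = j" using sees(1,2)[OF j(1)] by blast
  have "\<not> (E x a \<and> E x b)"
    using no_hub[OF F(2,1,3,4,5) _ j(1) x(2) j(2)] F wx ux x edge_sym by blast
  then have "s \<noteq> x \<or> t \<noteq> x" using st edge_sym by blast
  then obtain y where y: "y \<in> V" "f y = j" "y \<noteq> x" using st edge_in2 by blast
  note yn = near[OF y] and yf = far[OF y(2,3)]
  have ya: "z = y" if "E a z" "f z = j" for z
    using not_twiceD[OF o(3)[OF j(1)]] that yn edge_sym y by blast
  have ya': "z = y" if "E a' z" "f z = j" for z
    using not_twiceD[OF o(4)[OF j(1)]] that yn edge_sym y by blast
  have fk: "z = v" if "z \<in> V" "f z = k" for z using F(2) that by (auto simp: hole_def)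
  have nonadj: "\<not> E u w" "\<not> E u u" "\<not> E v b" "\<not> E v b'" "\<not> E a' a" "\<not> E y y" "\<not> E u y"
    using F(1) X(3) hole_edge[OF F(2), of a' a] F(7) a'(2) edge_irrefl yf
    by (auto simp: pentagon_def edge_commute)
  \<comment> \<open>The vertex \<open>y\<close> is uncoloured for a while, so that every single step is proper.\<close>
  define f1 where "f1 = f(y := k)"
  define f2 where "f2 = f1(a := j)"
  define f3 where "f3 = f2(a' := j)"
  define f4 where "f4 = f3(y := q)"
  define f5 where "f5 = f4(u := q)"
  define f6 where "f6 = f5(v := p)"
  have ys: "y \<noteq> v" "y \<noteq> u" "y \<noteq> a" "y \<noteq> b" "y \<noteq> w" "y \<noteq> a'" "y \<noteq> b'"
    using y(2) jj F(6-9) a'(2) b'(2) config_hole[OF c] by auto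
  have "proper f1" unfolding f1_def
  proof (rule proper_update[OF hole_proper[OF F(2)]])
    show "f z \<noteq> k" if "E y z" for z using fk edge_in2 yf(1) that by blast
  qed
  then have "proper f2" unfolding f2_def
  proof (rule proper_update)
    show "f1 z \<noteq> j" if "E a z" for z using ya[OF that] jj(1) by (auto simp: f1_def)
  qed
  then have "proper f3" unfolding f3_def
  proof (rule proper_update)
    show "f2 z \<noteq> j" if "E a' z" for z
      using ya'[OF that] jj(1) nonadj(5) that by (auto simp: f1_def f2_def)
  qed
  then have "proper f4" unfolding f4_def
  proof (rule proper_update)
    show "f3 z \<noteq> q" if "E y z" for z
      using clq[OF edge_in2[OF that]] jj(3) yf(3) F(4) that by (auto simp: f1_def f2_def f3_def)
  qed
  then have "proper f5" unfolding f5_def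
  proof (rule proper_update)
    show "f4 z \<noteq> q" if "E u z" for z
      using clq[OF edge_in2[OF that]] jj(3) nonadj(1,7) that ys by (auto simp: f1_def f2_def f3_def f4_def)
  qed
  then have "proper f6" unfolding f6_def
  proof (rule proper_update)
    show "f5 z \<noteq> p" if "E v z" for z
      using clp[OF edge_in2[OF that]] jj(2) F(5) nonadj(3,4) that by (auto simp: f1_def f2_def f3_def f4_def f5_def)
  qed
  moreover have "f6 z < k" if "z \<in> V" for z
    using hole_less[OF F(2) that] F(3,4) jj(1) by (auto simp: f1_def f2_def f3_def f4_def f5_def f6_def)
  ultimately show False using proper_large[of f6] not_le by blast
qed

lemma unique_nbrs_adjacent:
  assumes h: "hole v f" and u: "E v u" "\<And>x. E v x \<Longrightarrow> f x = f u \<Longrightarrow> x = u"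
    and w: "E v w" "\<And>x. E v x \<Longrightarrow> f x = f w \<Longrightarrow> x = w" and uw: "u \<noteq> w"
  shows "E u w"
proof (rule ccontr)
  assume n: "\<not> E u w"
  have ne: "f w \<noteq> f u" using u(2)[OF w(1)] uw by blast
  obtain z where z: "E v z" "f z = f w" "E u z \<or> (\<exists>a b. f a = f w \<and> f b = f u \<and> pentagon v u a b z)"
    using kempe[OF h u hole_nbr_less[OF h w(1)] ne] by blast
  then obtain a b where "f a = f w" "f b = f u" "pentagon v u a b w"
    using w(2) n by blast
  then have "config v u a b w f (f u) (f w)"
    using h u w ne by (auto simp: config_def)
  then show False using no_config by blast
qed

end

section \<open>Hall's marriage theorem\<close>

text \<open>
  Induction on the size of the index set after Halmos and Vaughan: either some proper nonempty
  subset satisfies the condition with equality, and the problem splits, or any choice for a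
  single index leaves the condition intact.
\<close>

lemma marriage:
  assumes "finite I" "\<And>i. i \<in> I \<Longrightarrow> finite (A i)" "\<And>J. J \<subseteq> I \<Longrightarrow> card J \<le> card (\<Union>(A ` J))"
  shows "\<exists>h. inj_on h I \<and> (\<forall>i\<in>I. h i \<in> A i)"
  using assms
proof (induction "card I" arbitrary: I A rule: less_induct)
  case less
  note finI = less.prems(1) and finA = less.prems(2) and cond = less.prems(3)
  have finU: "finite (\<Union>(A ` J))" if "J \<subseteq> I" for J
    using that finI finA by (meson finite_UN finite_subset subsetD)
  show ?case
  proof (cases "I = {}")
    case False
    then obtain i where i: "i \<in> I" by blast
    show ?thesis
    proof (cases "\<exists>J. J \<noteq> {} \<and> J \<subset> I \<and> card (\<Union>(A ` J)) = card J")
      case True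
      then obtain J where J: "J \<noteq> {}" "J \<subset> I" "card (\<Union>(A ` J)) = card J" by blast
      let ?U = "\<Union>(A ` J)"
      have finJ: "finite J" using J finI finite_subset by blast
      have less1: "card J < card I" using J finI by (simp add: psubset_card_mono)
      have less2: "card (I - J) < card I"
        using J finI by (intro psubset_card_mono) auto
      have "\<exists>h. inj_on h J \<and> (\<forall>i\<in>J. h i \<in> A i)"
      proof (rule less.hyps[OF less1 finJ])
        show "finite (A i)" if "i \<in> J" for i using finA J(2) that by blast
        show "card K \<le> card (\<Union>(A ` K))" if "K \<subseteq> J" for K using cond[of K] J(2) that by blast
      qed
      then obtain h1 where h1: "inj_on h1 J" "\<forall>i\<in>J. h1 i \<in> A i" by blast
      have cond2: "card K \<le> card (\<Union>((\<lambda>i. A i - ?U) ` K))" if K: "K \<subseteq> I - J" for K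
      proof -
        have "finite K" using K finI finite_subset by blast
        then have "card K + card J = card (K \<union> J)"
          using K finJ by (intro card_Un_disjoint[symmetric]) auto
        also have "\<dots> \<le> card (\<Union>(A ` (K \<union> J)))" using K J by (intro cond) auto
        also have "\<Union>(A ` (K \<union> J)) = \<Union>((\<lambda>i. A i - ?U) ` K) \<union> ?U" by auto
        also have "card \<dots> \<le> card (\<Union>((\<lambda>i. A i - ?U) ` K)) + card ?U" by (rule card_Un_le)
        finally show ?thesis using J(3) by simp
      qed
      have "\<exists>h. inj_on h (I - J) \<and> (\<forall>i\<in>I - J. h i \<in> A i - ?U)"
        by (rule less.hyps[OF less2 _ _ cond2]) (use finI finA in auto)
      then obtain h2 where h2: "inj_on h2 (I - J)" "\<forall>i\<in>I - J. h2 i \<in> A i - ?U" by blast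
      define h where "h i = (if i \<in> J then h1 i else h2 i)" for i
      have cross: "h1 x \<noteq> h2 y" if "x \<in> J" "y \<in> I - J" for x y
        using that h1(2) h2(2) by fastforce
      have "x = y" if "x \<in> I" "y \<in> I" "h x = h y" for x y
      proof (cases "x \<in> J \<longleftrightarrow> y \<in> J")
        case True
        then show ?thesis
          using that inj_onD[OF h1(1), of x y] inj_onD[OF h2(1), of x y]
          by (cases "x \<in> J") (simp_all add: h_def)
      next
        case False
        then show ?thesis
          using that cross[of x y] cross[of y x] by (cases "x \<in> J") (simp_all add: h_def)
      qed
      then have "inj_on h I" by (auto intro: inj_onI)
      moreover have "\<forall>i\<in>I. h i \<in> A i" using h1 h2 by (auto simp: h_def)
      ultimately show ?thesis by blast
    next
      case False
      have "card {i} \<le> card (A i)" using cond[of "{i}"] i by simp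
      then obtain x where x: "x \<in> A i" by fastforce
      have less1: "card (I - {i}) < card I" using i finI by (rule card_Diff1_less[rotated])
      have cond2: "card K \<le> card (\<Union>((\<lambda>j. A j - {x}) ` K))" if K: "K \<subseteq> I - {i}" for K
      proof (cases "K = {}")
        case nonempty: False
        have "card K \<le> card (\<Union>(A ` K))" "card (\<Union>(A ` K)) \<noteq> card K"
          using cond[of K] False K i nonempty by blast+
        moreover have "\<Union>((\<lambda>j. A j - {x}) ` K) = \<Union>(A ` K) - {x}" by auto
        moreover have "card (\<Union>(A ` K)) - 1 \<le> card (\<Union>(A ` K) - {x})"
          using finU[of K] K by (simp add: card_Diff_singleton_if)
        ultimately show ?thesis by simp
      qed simp
      have "\<exists>h. inj_on h (I - {i}) \<and> (\<forall>j\<in>I - {i}. h j \<in> A j - {x})"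
        by (rule less.hyps[OF less1 _ _ cond2]) (use finI finA in auto)
      then obtain h where h: "inj_on h (I - {i})" "\<forall>j\<in>I - {i}. h j \<in> A j - {x}" by blast
      have "inj_on (h(i := x)) (insert i (I - {i}))"
        using h by (auto simp: inj_on_def)
      then have "inj_on (h(i := x)) I" using i by (simp add: insert_absorb)
      moreover have "\<forall>j\<in>I. (h(i := x)) j \<in> A j" using h x by auto
      ultimately show ?thesis by blast
    qed
  qed simp
qed

section \<open>Cliques with two non-adjacent common neighbours\<close>

context critical_graph begin

definition partial_colouring :: "'a set \<Rightarrow> ('a \<Rightarrow> nat) \<Rightarrow> bool" where
  "partial_colouring S g \<longleftrightarrow> S \<subseteq> V \<and> (\<forall>x\<in>S. g x < k) \<and> (\<forall>x\<in>S. \<forall>y\<in>S. E x y \<longrightarrow> g x \<noteq> g y)"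

lemma partial_update:
  assumes g: "partial_colouring (S - {x}) g" and c: "x \<in> V" "c < k" "\<And>y. y \<in> S \<Longrightarrow> E x y \<Longrightarrow> g y \<noteq> c"
  shows "partial_colouring S (g(x := c))"
  unfolding partial_colouring_def
proof (intro conjI ballI impI)
  show "S \<subseteq> V" using g c by (auto simp: partial_colouring_def)
  show "(g(x := c)) y < k" if "y \<in> S" for y using g c that by (auto simp: partial_colouring_def)
  show "(g(x := c)) y \<noteq> (g(x := c)) z" if "y \<in> S" "z \<in> S" "E y z" for y z
    using g c(3)[of y] c(3)[of z] that edge_sym[OF that(3)] edge_irrefl by (auto simp: partial_colouring_def)
qed

lemma partial_subset: "partial_colouring S g \<Longrightarrow> T \<subseteq> S \<Longrightarrow> partial_colouring T g"
  unfolding partial_colouring_def by blast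

lemma hole_partial: "hole v f \<Longrightarrow> partial_colouring (V - {v}) f"
  using hole_edge hole_less by (fastforce simp: partial_colouring_def)

lemma fresh_colour:
  assumes "finite T" "card T < k" shows "\<exists>c<k. c \<notin> T"
proof (rule ccontr)
  assume "\<not> ?thesis"
  then have sub: "{..<k} \<subseteq> T" by auto
  show False using card_mono[OF assms(1) sub] assms(2) by simp
qed

text \<open>
  The colours left for \<open>r\<close> when the graph is coloured outside \<open>R\<close>.
\<close>

definition available :: "('a \<Rightarrow> nat) \<Rightarrow> 'a set \<Rightarrow> 'a \<Rightarrow> nat set" where
  "available g R r = {..<k} - g ` {z. E r z \<and> z \<notin> R}"

text \<open>
  Distinct available colours for the vertices of \<open>R\<close> would give a colouring of the graph.
\<close>

lemma marriage_violation:
  assumes R: "R \<subseteq> V" and g: "partial_colouring (V - R) g"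
  obtains S where "S \<subseteq> R" "card (\<Union>(available g R ` S)) < card S"
proof (rule ccontr)
  assume "\<not> thesis"
  then have cond: "card S \<le> card (\<Union>(available g R ` S))" if "S \<subseteq> R" for S
    using that \<open>\<And>S. \<lbrakk>S \<subseteq> R; card (\<Union>(available g R ` S)) < card S\<rbrakk> \<Longrightarrow> thesis\<close> not_le by blast
  have "\<exists>h. inj_on h R \<and> (\<forall>r\<in>R. h r \<in> available g R r)"
  proof (rule marriage)
    show "finite R" using R finite_V by (rule finite_subset)
    show "finite (available g R r)" for r by (simp add: available_def)
  qed (rule cond)
  then obtain h where h: "inj_on h R" "\<forall>r\<in>R. h r \<in> available g R r" by blast
  define f where "f x = (if x \<in> R then h x else g x)" for x
  have "f x < k" if "x \<in> V" for x
    using that h g by (auto simp: f_def available_def partial_colouring_def)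
  then obtain x y where xy: "E x y" "f x = f y" using not_colourable by blast
  have "x \<in> V" "y \<in> V" "x \<noteq> y" using xy edge_in edge_in2 edge_irrefl by auto
  note xyV = this
  have mixed: "h r \<noteq> g z" if "r \<in> R" "z \<notin> R" "E r z" for r z
    using h(2) that unfolding available_def by blast
  show False
  proof (cases "x \<in> R \<longleftrightarrow> y \<in> R")
    case True
    then show False
      using xy xyV inj_onD[OF h(1), of x y] g by (cases "x \<in> R") (auto simp: f_def partial_colouring_def)
  next
    case False
    then show False
      using xy mixed[of x y] mixed[of y x] edge_sym[OF xy(1)] by (auto simp: f_def)
  qed
qed

lemma outside_nbrs:
  assumes x: "x \<in> V" and S: "S \<subseteq> {y. E x y}" "S \<inter> T = {}"
  shows "card {y \<in> T. E x y} \<le> k + 1 - card S"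
proof -
  have "finite S" "finite {y \<in> T. E x y}" using S finite_subset[OF _ finite_nbrs[of x]] by auto
  then have "card S + card {y \<in> T. E x y} = card (S \<union> {y \<in> T. E x y})"
    using S by (intro card_Un_disjoint[symmetric]) auto
  also have "\<dots> \<le> card {y. E x y}" using S by (intro card_mono finite_nbrs) auto
  also have "\<dots> \<le> k + 1" using degree_le[OF x] .
  finally show ?thesis by simp
qed

text \<open>
  The complete graph \<open>R\<close> joined to two non-adjacent vertices uses up \<open>k\<close> of the at most \<open>k + 1\<close>
  edges at each vertex of \<open>R\<close>, so these vertices have at most one neighbour elsewhere.
\<close>

context
  fixes R :: "'a set" and p q :: 'a
  assumes R: "R \<subseteq> V" "\<And>x y. x \<in> R \<Longrightarrow> y \<in> R \<Longrightarrow> x \<noteq> y \<Longrightarrow> E x y" "card R = k - 1"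
    and pq: "p \<noteq> q" "\<not> E p q" "\<And>r. r \<in> R \<Longrightarrow> E p r" "\<And>r. r \<in> R \<Longrightarrow> E q r"
begin

abbreviation (input) "Out \<equiv> V - insert p (insert q R)"

lemma apex_in: "p \<in> V" "q \<in> V" "p \<notin> R" "q \<notin> R"
proof -
  have "R \<noteq> {}" using R(3) k_ge by auto
  then show "p \<in> V" "q \<in> V" using pq(3,4) edge_in by blast+
  show "p \<notin> R" "q \<notin> R" using pq(3,4) edge_irrefl by blast+
qed

lemma finite_R: "finite R"
  using R(1) finite_V finite_subset by blast

lemma core_one_outside:
  assumes r: "r \<in> R" and z: "z \<in> Out" "E r z" and z': "z' \<in> Out" "E r z'"
  shows "z = z'"
proof (rule ccontr)
  assume ne: "z \<noteq> z'"
  let ?S = "insert p (insert q (R - {r}))"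
  have "card {y \<in> Out. E r y} \<le> k + 1 - card ?S"
    using r R pq edge_sym by (intro outside_nbrs) blast+
  moreover have "card ?S = k"
    using apex_in pq(1) finite_R r R(3) k_ge by simp
  ultimately have "card {y \<in> Out. E r y} \<le> 1" by simp
  moreover have "card {z, z'} \<le> card {y \<in> Out. E r y}"
    using z z' finite_V by (intro card_mono) auto
  ultimately show False using ne by simp
qed

lemma apex_outside:
  assumes "y \<in> V" "\<And>r. r \<in> R \<Longrightarrow> E y r"
  shows "card {x \<in> Out. E y x} \<le> 2"
proof -
  have "card {x \<in> Out. E y x} \<le> k + 1 - card R"
    using assms by (intro outside_nbrs) auto
  then show ?thesis using R(3) k_ge by simp
qed

text \<open>
  Give both \<open>p\<close> and \<open>q\<close> the colour \<open>c\<close>.  This leaves \<open>k - 1\<close> colours for \<open>R\<close>, of which each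
  vertex loses at most one; Hall's condition can only fail if all vertices lose the same one.
\<close>

lemma core_same_colour:
  assumes g: "partial_colouring Out g" and c: "c < k"
    "c \<notin> g ` {x \<in> Out. E p x}" "c \<notin> g ` {x \<in> Out. E q x}"
  shows "\<exists>\<alpha>. \<alpha> \<noteq> c \<and> (\<forall>r\<in>R. \<exists>z\<in>Out. E r z \<and> g z = \<alpha>)"
proof -
  define g' where "g' = g(p := c, q := c)"
  have "partial_colouring (insert p Out) (g(p := c))"
  proof (rule partial_update)
    show "partial_colouring (insert p Out - {p}) g" using g by (rule partial_subset) auto
    show "g y \<noteq> c" if "y \<in> insert p Out" "E p y" for y
      using that c edge_irrefl by auto
  qed (use apex_in c in auto)
  moreover have "V - R - {q} = insert p Out" using apex_in pq(1) by auto
  ultimately have gp: "partial_colouring (V - R - {q}) (g(p := c))" by simp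
  have "partial_colouring (V - R) g'" unfolding g'_def
  proof (rule partial_update[OF gp apex_in(2) c(1)])
    show "(g(p := c)) y \<noteq> c" if "y \<in> V - R" "E q y" for y
      using that c(3) pq(2) edge_sym[OF that(2)] edge_irrefl by auto
  qed
  then obtain S where S: "S \<subseteq> R" "card (\<Union>(available g' R ` S)) < card S"
    using marriage_violation[OF R(1)] by blast
  have available: "available g' R r = {..<k} - {c} - g ` {z \<in> Out. E r z}" if r: "r \<in> R" for r
  proof -
    have "E r p" "E r q" using pq(3,4) r edge_sym by blast+
    then have "{z. E r z \<and> z \<notin> R} = insert p (insert q {z \<in> Out. E r z})"
      using apex_in(3,4) edge_in2 by blast
    moreover have "g' ` {z \<in> Out. E r z} = g ` {z \<in> Out. E r z}"
      by (auto simp: g'_def)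
    ultimately show ?thesis by (auto simp: available_def g'_def)
  qed
  have fin: "finite (\<Union>(available g' R ` S))"
    using S finite_R finite_subset by (auto simp: available_def)
  obtain r where r: "r \<in> S" using S by fastforce
  let ?N = "g ` {z \<in> Out. E r z}"
  have finO: "finite {z \<in> Out. E r z}" using finite_V by simp
  have "card {z \<in> Out. E r z} \<le> 1"
    unfolding One_nat_def card_le_Suc0_iff_eq[OF finO] using core_one_outside r S(1) by blast
  then have "card ?N \<le> 1" "finite ?N" using card_image_le[OF finO, of g] finO by simp_all
  then have "card ({..<k} - {c}) - 1 \<le> card ({..<k} - {c} - ?N)"
    using diff_card_le_card_Diff[of ?N "{..<k} - {c}"] by linarith
  also have "\<dots> = card (available g' R r)" using available[of r] r S(1) by (simp add: subsetD)
  also have "\<dots> \<le> card (\<Union>(available g' R ` S))" using fin r by (intro card_mono) auto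
  finally have "k - 2 \<le> card (\<Union>(available g' R ` S))" using c(1) by simp
  moreover have "card S \<le> k - 1" using S(1) R(3) finite_R card_mono by metis
  ultimately have cS: "card S = k - 1" "card (\<Union>(available g' R ` S)) < k - 1" using S(2) by linarith+
  then have "S = R" using S(1) R(3) finite_R card_subset_eq by metis
  have "\<not> {..<k} - {c} \<subseteq> \<Union>(available g' R ` S)"
    using card_mono[OF fin, of "{..<k} - {c}"] cS(2) c(1) by auto
  then obtain \<alpha> where "\<alpha> < k" "\<alpha> \<noteq> c" "\<alpha> \<notin> \<Union>(available g' R ` R)"
    using \<open>S = R\<close> by auto
  then show ?thesis using available by (intro exI[of _ \<alpha>]) auto
qed

text \<open>
  Every vertex \<open>r\<close> of \<open>R\<close> has one neighbour \<open>z r\<close> elsewhere, and all of these have the same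
  colour \<open>\<alpha>\<close>.  Three different ones would give an induced \<open>P\<^sub>4 \<union> K\<^sub>1\<close>.  Hence some vertex
  \<open>y\<close> is \<open>z r\<close> for at least four \<open>r\<close>, so that few colours are seen by \<open>y\<close> elsewhere.
  Recolouring \<open>y\<close> destroys the situation: if \<open>y\<close> is not the only value of \<open>z\<close>, then a colour
  other than \<open>\<alpha>\<close> will do, and otherwise \<open>y\<close> takes the common colour of \<open>p\<close> and \<open>q\<close>.
\<close>

lemma no_double_apex: False
proof -
  obtain f where f: "hole p f" using hole_exists apex_in by blast
  have g: "partial_colouring Out f" by (rule partial_subset[OF hole_partial[OF f]]) auto
  have finO: "finite {x \<in> Out. E y x}" for y using finite_V by simp
  have im: "card (h ` {x \<in> Out. E y x}) \<le> card {x \<in> Out. E y x}" for y and h :: "'a \<Rightarrow> nat"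
    by (rule card_image_le[OF finO])
  have p2: "card {x \<in> Out. E p x} \<le> 2" and q2: "card {x \<in> Out. E q x} \<le> 2"
    using apex_outside apex_in pq by blast+
  have seen: "card (h ` {x \<in> Out. E p x} \<union> h ` {x \<in> Out. E q x}) \<le> 4" for h :: "'a \<Rightarrow> nat"
    using card_Un_le[of "h ` {x \<in> Out. E p x}" "h ` {x \<in> Out. E q x}"] im[of h p] im[of h q] p2 q2
    by linarith
  have same: "\<exists>\<alpha>. \<forall>r\<in>R. \<exists>z\<in>Out. E r z \<and> h z = \<alpha>" if h: "partial_colouring Out h" for h
  proof -
    obtain c where "c < k" "c \<notin> h ` {x \<in> Out. E p x} \<union> h ` {x \<in> Out. E q x}"
      using fresh_colour[of "h ` {x \<in> Out. E p x} \<union> h ` {x \<in> Out. E q x}"] seen[of h] k_ge finO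
      by auto
    then show ?thesis using core_same_colour[OF h, of c] by blast
  qed
  obtain \<alpha> where "\<forall>r\<in>R. \<exists>z\<in>Out. E r z \<and> f z = \<alpha>" using same[OF g] by blast
  then obtain z where z: "\<And>r. r \<in> R \<Longrightarrow> z r \<in> Out \<and> E r (z r) \<and> f (z r) = \<alpha>" by metis
  have zO: "z r \<in> Out" and zE: "E r (z r)" and z\<alpha>: "f (z r) = \<alpha>" if "r \<in> R" for r
    using z[OF that] by simp_all
  have only: "y = z r" if "r \<in> R" "y \<in> Out" "E r y" for r y
    using core_one_outside[OF that zO[OF that(1)] zE[OF that(1)]] .
  define Z where "Z = z ` R"
  have finZ: "finite Z" using finite_R by (simp add: Z_def)
  have "card Z \<le> 2"
  proof (rule ccontr)
    assume "\<not> card Z \<le> 2"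
    then obtain T where T: "T \<subseteq> Z" "card T = 3" using obtain_subset_with_card_n[of 3 Z] by auto
    then obtain a b c where abc: "T = {a, b, c}" "a \<noteq> b" "a \<noteq> c" "b \<noteq> c"
      by (auto simp: card_3_iff)
    have "\<exists>r\<in>R. z r = x" if "x \<in> T" for x using T(1) that unfolding Z_def by blast
    then obtain r s t where rst: "r \<in> R" "z r = a" "s \<in> R" "z s = b" "t \<in> R" "z t = c"
      using abc(1) by (metis insertCI)
    have stable: "\<not> E (z x) (z y)" if "x \<in> R" "y \<in> R" for x y
      using hole_edge[OF f, of "z x" "z y"] z\<alpha>[OF that(1)] z\<alpha>[OF that(2)] by auto
    have non: "\<not> E (z y) x" if "x \<in> R" "y \<in> R" "z x \<noteq> z y" for x y
      using only[OF that(1) zO[OF that(2)] edge_sym] that(3) by auto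
    have ne: "z r \<noteq> z s" "z r \<noteq> z t" "z s \<noteq> z t" using rst abc by auto
    have "E (z r) r" "E s (z s)" using edge_sym[OF zE[OF rst(1)]] zE[OF rst(3)] .
    moreover have "E r s" using R(2)[OF rst(1,3)] ne(1) by blast
    moreover have "\<not> E (z r) s" using non[OF rst(3,1)] ne(1) by simp
    moreover have "\<not> E r (z s)" using non[OF rst(1,3)] ne(1) edge_sym by blast
    moreover have "z t \<in> V" using zO[OF rst(5)] by blast
    ultimately have "E (z t) (z r) \<or> E (z t) r \<or> E (z t) s \<or> E (z t) (z s)"
      using stable[OF rst(1,3)] by (intro dominating_P4)
    then show False
      using stable[OF rst(5,1)] stable[OF rst(5,3)] non[OF rst(1,5)] non[OF rst(3,5)] ne by blast
  qed
  have "\<exists>y\<in>Z. 4 \<le> card {r \<in> R. z r = y}"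
  proof (rule ccontr)
    assume "\<not> ?thesis"
    then have le: "card {r \<in> R. z r = y} \<le> 3" if "y \<in> Z" for y using that by force
    have "R = (\<Union>y\<in>Z. {r \<in> R. z r = y})" by (auto simp: Z_def)
    then have "card R \<le> (\<Sum>y\<in>Z. card {r \<in> R. z r = y})" using card_UN_le[OF finZ] by metis
    also have "\<dots> \<le> of_nat (card Z) * 3" by (rule sum_bounded_above) (rule le)
    finally show False using \<open>card Z \<le> 2\<close> R(3) k_ge by simp
  qed
  then obtain y where y: "y \<in> Z" "4 \<le> card {r \<in> R. z r = y}" by blast
  have yO: "y \<in> Out" "f y = \<alpha>" using y(1) zO z\<alpha> unfolding Z_def by blast+
  have upd: "partial_colouring Out (f(y := c))" if "c < k" "c \<notin> f ` {x \<in> Out. E y x}" for c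
  proof (rule partial_update)
    show "partial_colouring (Out - {y}) f" using g by (rule partial_subset) blast
    show "f x \<noteq> c" if "x \<in> Out" "E y x" for x using that \<open>c \<notin> f ` {x \<in> Out. E y x}\<close> by blast
  qed (use that yO in blast)+
  show False
  proof (cases "Z = {y}")
    case True
    then have zy: "z r = y" if "r \<in> R" for r using that unfolding Z_def by blast
    have yR: "E y r" if "r \<in> R" for r using edge_sym[OF zE[OF that]] zy[OF that] by simp
    have no: "\<not> E s y" if s: "s \<in> V" "s \<notin> R" "s \<noteq> y" "\<And>r. r \<in> R \<Longrightarrow> E s r" for s
    proof
      assume sy: "E s y"
      have "card (insert s (insert y R)) \<le> k"
      proof (rule clique_le)
        show "insert s (insert y R) \<subseteq> V" using s(1) yO(1) R(1) by blast
        show "E a b" if "a \<in> insert s (insert y R)" "b \<in> insert s (insert y R)" "a \<noteq> b" for a b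
          using that sy edge_sym[OF sy] s(4) yR edge_sym[OF s(4)] edge_sym[OF yR] R(2) by blast
      qed
      then show False using s yO finite_R R(3) k_ge by simp
    qed
    have py: "\<not> E p y" "\<not> E q y"
      using no[OF apex_in(1,3) _ pq(3)] no[OF apex_in(2,4) _ pq(4)] yO(1) by blast+
    let ?T = "f ` {x \<in> Out. E p x} \<union> f ` {x \<in> Out. E q x} \<union> f ` {x \<in> Out. E y x}"
    have "card {x \<in> Out. E y x} \<le> 2" using apex_outside yO yR by blast
    then have "card ?T < k"
      using card_Un_le[of "f ` {x \<in> Out. E p x} \<union> f ` {x \<in> Out. E q x}" "f ` {x \<in> Out. E y x}"]
        seen[of f] im[of f y] k_ge by linarith
    then obtain c where c: "c < k" "c \<notin> ?T" using fresh_colour[of ?T] finO by blast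
    have "partial_colouring Out (f(y := c))" using c by (intro upd) auto
    moreover have "c \<notin> (f(y := c)) ` {x \<in> Out. E p x}" "c \<notin> (f(y := c)) ` {x \<in> Out. E q x}"
      using c(2) py by auto
    ultimately obtain \<beta> where \<beta>: "\<beta> \<noteq> c" "\<forall>r\<in>R. \<exists>x\<in>Out. E r x \<and> (f(y := c)) x = \<beta>"
      using core_same_colour[OF _ c(1)] by blast
    obtain r where r: "r \<in> R" using y(1) by (auto simp: Z_def)
    then obtain x where x: "x \<in> Out" "E r x" "(f(y := c)) x = \<beta>" using \<beta>(2) by blast
    have "x = y" using only[OF r x(1,2)] zy[OF r] by simp
    then show False using x(3) \<beta>(1) by simp
  next
    case False
    then obtain y' where y': "y' \<in> Z" "y' \<noteq> y" using y(1) by blast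
    have "card {x \<in> Out. E y x} \<le> k + 1 - card {r \<in> R. z r = y}"
    proof (rule outside_nbrs)
      show "{r \<in> R. z r = y} \<subseteq> {r. E y r}" using edge_sym[OF zE] by blast
    qed (use yO in blast)+
    then have "card (f ` {x \<in> Out. E y x}) + 1 < k"
      using y(2) im[of f y] k_ge by linarith
    then have "card (insert \<alpha> (f ` {x \<in> Out. E y x})) < k"
      using card_insert_le_m1[of "card (f ` {x \<in> Out. E y x}) + 1" "f ` {x \<in> Out. E y x}" \<alpha>] by simp
    then obtain \<beta> where \<beta>: "\<beta> < k" "\<beta> \<noteq> \<alpha>" "\<beta> \<notin> f ` {x \<in> Out. E y x}"
      using fresh_colour[of "insert \<alpha> (f ` {x \<in> Out. E y x})"] finO by blast
    obtain \<gamma> where \<gamma>: "\<forall>r\<in>R. \<exists>x\<in>Out. E r x \<and> (f(y := \<beta>)) x = \<gamma>"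
      using same[OF upd[OF \<beta>(1,3)]] by blast
    have see: "(f(y := \<beta>)) (z r) = \<gamma>" if "r \<in> R" for r
      using \<gamma> only[OF that] that by metis
    obtain r r' where r: "r \<in> R" "z r = y" "r' \<in> R" "z r' = y'"
      using y(1) y'(1) unfolding Z_def by blast
    have "\<gamma> = \<beta>" using see[OF r(1)] r(2) by simp
    moreover have "\<gamma> = \<alpha>" using see[OF r(3)] r(4) z\<alpha>[OF r(3)] y'(2) by simp
    ultimately show False using \<beta>(2) by simp
  qed
qed

end

section \<open>Cliques with \<open>k\<close> vertices\<close>

definition clique :: "'a set \<Rightarrow> bool" where
  "clique C \<longleftrightarrow> C \<subseteq> V \<and> (\<forall>x\<in>C. \<forall>y\<in>C. x \<noteq> y \<longrightarrow> E x y)"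

lemma cliqueD: "clique C \<Longrightarrow> x \<in> C \<Longrightarrow> y \<in> C \<Longrightarrow> x \<noteq> y \<Longrightarrow> E x y"
  by (simp add: clique_def)

lemma clique_card: "clique C \<Longrightarrow> card C \<le> k"
  by (rule clique_le) (auto simp: clique_def)

lemma clique_few_nbrs:
  assumes Q: "clique Q" "card Q = k" and y: "y \<in> V" "y \<notin> Q"
  shows "card {x \<in> Q. E y x} \<le> k - 2"
proof (rule ccontr)
  assume n: "\<not> ?thesis"
  have finQ: "finite Q" using Q(1) finite_V finite_subset unfolding clique_def by blast
  let ?R = "{x \<in> Q. E y x}"
  have "?R \<noteq> Q"
  proof
    assume "?R = Q"
    then have "E y x" if "x \<in> Q" for x using that by blast
    then have "clique (insert y Q)" using Q(1) y(1) edge_sym unfolding clique_def by blast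
    then have "card (insert y Q) \<le> k" by (rule clique_card)
    then show False using y(2) finQ Q(2) by simp
  qed
  then obtain q where q: "q \<in> Q" "q \<notin> ?R" by blast
  have "?R \<subseteq> Q - {q}" using q by blast
  moreover have "card (Q - {q}) = k - 1" using q(1) finQ Q(2) by simp
  moreover have "k - 1 \<le> card ?R" using n k_ge by simp
  ultimately have R: "?R = Q - {q}" using finQ by (intro card_seteq) auto
  have "card ?R = k - 1" using R \<open>card (Q - {q}) = k - 1\<close> by simp
  moreover have "E q r" if r: "r \<in> ?R" for r
  proof -
    have "q \<noteq> r" "r \<in> Q" using r q(2) by blast+
    then show ?thesis using q(1) Q(1) unfolding clique_def by blast
  qed
  moreover have "y \<noteq> q" "\<not> E y q" using q y(2) by auto
  ultimately show False
    using no_double_apex[of ?R y q] Q(1) unfolding clique_def by blast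
qed

text \<open>
  All \<open>k\<close> colours occur among at most \<open>k + 1\<close> neighbours.  If none of them occurred twice, the
  hole and its pairwise adjacent neighbours would form too large a clique.
\<close>

lemma hole_structure:
  assumes h: "hole v f"
  obtains e where "e < k" "card {x. E v x \<and> f x = e} = 2"
    "clique (insert v {x. E v x \<and> f x \<noteq> e})" "card {x. E v x \<and> f x \<noteq> e} = k - 1"
    "inj_on f {x. E v x \<and> f x \<noteq> e}"
proof -
  have vV: "v \<in> V" using h by (simp add: hole_def)
  have lt: "f x < k" if "E v x" for x using hole_nbr_less[OF h that] .
  have ad: "E x y" if "E v x" "E v y" "x \<noteq> y" "\<not> twice f v (f x)" "\<not> twice f v (f y)" for x y
  proof (rule unique_nbrs_adjacent[OF h that(1) _ that(2) _ that(3)])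
    show "z = x" if "E v z" "f z = f x" for z
      using not_twiceD[OF \<open>\<not> twice f v (f x)\<close> that(1) \<open>E v x\<close> that(2)] by simp
    show "z = y" if "E v z" "f z = f y" for z
      using not_twiceD[OF \<open>\<not> twice f v (f y)\<close> that(1) \<open>E v y\<close> that(2)] by simp
  qed
  have cl: "clique (insert v U)" if "U \<subseteq> {x. E v x}" "\<And>x. x \<in> U \<Longrightarrow> \<not> twice f v (f x)" for U
    unfolding clique_def
  proof (intro conjI ballI impI)
    show "insert v U \<subseteq> V" using that(1) vV edge_in2 by blast
    show "E x y" if "x \<in> insert v U" "y \<in> insert v U" "x \<noteq> y" for x y
      using that \<open>U \<subseteq> {x. E v x}\<close> \<open>\<And>x. x \<in> U \<Longrightarrow> \<not> twice f v (f x)\<close> ad edge_sym by blast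
  qed
  have inj: "inj_on f U" if "U \<subseteq> {x. E v x}" "\<And>x. x \<in> U \<Longrightarrow> \<not> twice f v (f x)" for U
    using that not_twiceD by (intro inj_onI) (metis mem_Collect_eq subsetD)
  have "\<exists>e. twice f v e"
  proof (rule ccontr)
    assume n: "\<not> ?thesis"
    have "clique (insert v {x. E v x})" using n by (intro cl) auto
    then have "card (insert v {x. E v x}) \<le> k" by (rule clique_card)
    then have "card {x. E v x} < k" using finite_nbrs edge_irrefl by simp
    moreover have "{..<k} \<subseteq> f ` {x. E v x}" using hole_sees[OF h] by force
    then have "k \<le> card {x. E v x}"
      using card_mono[of "f ` {x. E v x}" "{..<k}"] card_image_le[OF finite_nbrs, of f v] finite_nbrs
      by (metis card_lessThan finite_imageI le_trans)
    ultimately show False by simp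
  qed
  then obtain e where e: "twice f v e" by blast
  then have ek: "e < k" using lt by (auto simp: twice_def)
  have "card ({} :: 'a set) + card {..<k} + card {j \<in> {..<k}. twice f v j} \<le> k + 1"
    by (rule degree_budget[OF vV]) (use hole_sees[OF h] in auto)
  then have "card {j \<in> {..<k}. twice f v j} \<le> 1" by simp
  then have once: "j = e" if "twice f v j" "j < k" for j
    using that e ek card_le_Suc0_iff_eq[of "{j \<in> {..<k}. twice f v j}"] by auto
  let ?U = "{x. E v x \<and> f x \<noteq> e}" and ?W = "{x. E v x \<and> f x = e}"
  have nt: "\<not> twice f v (f x)" if "x \<in> ?U" for x using once[of "f x"] lt that by auto
  have injU: "inj_on f ?U" using nt by (intro inj) auto
  have "f ` ?U = {..<k} - {e}"
  proof
    show "f ` ?U \<subseteq> {..<k} - {e}" using lt by auto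
    show "{..<k} - {e} \<subseteq> f ` ?U" using hole_sees[OF h] by force
  qed
  then have cU: "card ?U = k - 1" using card_image[OF injU] ek by simp
  have fin: "finite ?U" "finite ?W" using finite_nbrs by (auto intro: finite_subset[OF _ finite_nbrs[of v]])
  have "card ?U + card ?W = card {x. E v x}"
    using fin by (subst card_Un_disjoint[symmetric]) (auto intro: arg_cong[of _ _ card])
  then have "card ?W \<le> 2" using degree_le[OF vV] cU k_ge by simp
  moreover obtain a b where "a \<noteq> b" "{a, b} \<subseteq> ?W" using e by (auto simp: twice_def)
  then have "2 \<le> card ?W" using card_mono[OF fin(2), of "{a, b}"] by simp
  ultimately have "card ?W = 2" by simp
  moreover have "clique (insert v ?U)" using nt by (intro cl) auto
  ultimately show thesis using that ek cU injU by blast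
qed

text \<open>
  For \<open>u\<close> in the clique \<open>Q\<close> around the hole \<open>v\<close>, shift the hole to \<open>u\<close>.  If the colour seen
  twice by \<open>u\<close> were different from \<open>e\<close>, then the only neighbour of \<open>u\<close> with colour \<open>e\<close> would be
  adjacent to all vertices of \<open>Q\<close> but at most one, contrary to \<open>clique_few_nbrs\<close>.
\<close>

lemma monochromatic_boundary:
  obtains Q f e where "clique Q" "card Q = k" "partial_colouring (V - Q) f"
    "\<And>u x. u \<in> Q \<Longrightarrow> E u x \<Longrightarrow> x \<notin> Q \<Longrightarrow> f x = e"
    "\<And>u. u \<in> Q \<Longrightarrow> card {x. E u x \<and> x \<notin> Q} = 2"
proof -
  obtain v where v: "v \<in> V" using not_colourable[of "\<lambda>_. 0"] k_ge edge_in by fastforce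
  obtain f where h: "hole v f" using hole_exists[OF v] by blast
  obtain e where e: "e < k" "card {x. E v x \<and> f x = e} = 2"
    "clique (insert v {x. E v x \<and> f x \<noteq> e})" "card {x. E v x \<and> f x \<noteq> e} = k - 1"
    "inj_on f {x. E v x \<and> f x \<noteq> e}"
    using hole_structure[OF h] by blast
  define U where "U = {x. E v x \<and> f x \<noteq> e}"
  define Q where "Q = insert v U"
  have finU: "finite U" unfolding U_def using finite_nbrs[of v] by (rule rev_finite_subset) blast
  have vU: "v \<notin> U" using edge_irrefl by (auto simp: U_def)
  have Q: "clique Q" "card Q = k"
    using e(3,4) vU finU k_ge unfolding Q_def U_def by auto
  have finQ: "finite Q" using finU by (simp add: Q_def)
  note QE = cliqueD[OF Q(1)]
  have fv: "f v = k" using h by (simp add: hole_def)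
  have Qe: "f x \<noteq> e" if "x \<in> Q" for x using that e(1) fv by (auto simp: Q_def U_def)
  have main: "(\<forall>x. E u x \<longrightarrow> x \<notin> Q \<longrightarrow> f x = e) \<and> card {x. E u x \<and> x \<notin> Q} = 2" if u: "u \<in> Q" for u
  proof (cases "u = v")
    case True
    have "{x. E v x \<and> x \<notin> Q} = {x. E v x \<and> f x = e}"
      using edge_irrefl by (auto simp: Q_def U_def)
    then show ?thesis using True e(2) by auto
  next
    case False
    then have uU: "E v u" "f u \<noteq> e" "u \<in> U" using u by (auto simp: Q_def U_def)
    let ?g = "f(v := f u, u := k)"
    have uniq: "x = u" if "E v x" "f x = f u" for x
      using inj_onD[OF e(5), of x u] that uU by simp
    have h': "hole u ?g" by (rule hole_shift[OF h uU(1) uniq])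
    obtain e' where e': "card {x. E u x \<and> ?g x = e'} = 2"
      "clique (insert u {x. E u x \<and> ?g x \<noteq> e'})" "card {x. E u x \<and> ?g x \<noteq> e'} = k - 1"
      using hole_structure[OF h'] by blast
    have uQ: "E u x" if "x \<in> Q - {u}" for x
      using QE[OF u, of x] that by blast
    have gQ: "?g x \<noteq> e" if "x \<in> Q" for x using Qe[OF that] e(1) uU(2) by auto
    have "e' = e"
    proof (rule ccontr)
      assume ne: "e' \<noteq> e"
      obtain w where w: "E u w" "?g w = e" using hole_sees[OF h' e(1)] by blast
      have wQ: "w \<notin> Q" using gQ[of w] w(2) by blast
      have wV: "w \<in> V" using w(1) edge_in2 by blast
      let ?B = "{x \<in> Q - {u}. ?g x = e'}"
      have fu: "f x \<noteq> f u" if "x \<in> U" "x \<noteq> u" for x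
        using uniq[of x] that by (auto simp: U_def)
      have inj: "x = y" if xy: "x \<in> Q - {u}" "y \<in> Q - {u}" "?g x = ?g y" for x y
      proof (cases "x = v \<or> y = v")
        case True
        then show ?thesis using xy fu[of x] fu[of y] by (auto simp: Q_def split: if_splits)
      next
        case False
        then have "x \<in> U" "y \<in> U" "f x = f y" using xy by (auto simp: Q_def)
        then show ?thesis using inj_onD[OF e(5)] unfolding U_def by blast
      qed
      have "\<forall>x\<in>?B. \<forall>y\<in>?B. x = y"
      proof (intro ballI)
        fix x y assume "x \<in> ?B" "y \<in> ?B"
        then have "x \<in> Q - {u}" "y \<in> Q - {u}" "?g x = e'" "?g y = e'" by blast+
        then show "x = y" by (intro inj) (simp_all only:)
      qed
      moreover have finB: "finite ?B" using finQ by simp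
      ultimately have "card ?B \<le> 1" unfolding One_nat_def card_le_Suc0_iff_eq[OF finB] by blast
      then have "k - 1 \<le> card (Q - ?B)"
        using diff_card_le_card_Diff[of ?B Q] Q(2) finB by linarith
      also have "\<dots> \<le> card {x \<in> Q. E w x}"
      proof (rule card_mono)
        show "Q - ?B \<subseteq> {x \<in> Q. E w x}"
        proof
          fix x assume x: "x \<in> Q - ?B"
          show "x \<in> {x \<in> Q. E w x}"
          proof (cases "x = u")
            case True
            then show ?thesis using w(1) u edge_sym by blast
          next
            case False
            then have "x \<in> {x. E u x \<and> ?g x \<noteq> e'}" using x uQ[of x] by blast
            moreover have "w \<in> {x. E u x \<and> ?g x \<noteq> e'}" using w ne by blast
            moreover have "w \<noteq> x" using wQ x by blast
            ultimately have "E w x" by (intro cliqueD[OF e'(2)]) blast+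
            then show ?thesis using x by blast
          qed
        qed
      qed (use finQ in simp)
      finally show False using clique_few_nbrs[OF Q wV wQ] k_ge by simp
    qed
    note e' = e'[unfolded this]
    have "Q - {u} \<subseteq> {x. E u x \<and> ?g x \<noteq> e}" using uQ gQ by blast
    moreover have "card (Q - {u}) = k - 1" using u finQ Q(2) by simp
    moreover have "finite {x. E u x \<and> ?g x \<noteq> e}"
      using finite_nbrs[of u] by (rule rev_finite_subset) blast
    ultimately have eq: "Q - {u} = {x. E u x \<and> ?g x \<noteq> e}"
      using card_subset_eq[of "{x. E u x \<and> ?g x \<noteq> e}" "Q - {u}"] e'(3) by simp
    have out: "x \<notin> Q \<longleftrightarrow> ?g x = e" if x: "E u x" for x
    proof -
      have "x \<noteq> u" using x edge_irrefl by blast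
      then show ?thesis using eq x by blast
    qed
    then have "{x. E u x \<and> x \<notin> Q} = {x. E u x \<and> ?g x = e}" by blast
    moreover have "f x = e" if "E u x" "x \<notin> Q" for x
    proof -
      have "x \<noteq> v" "x \<noteq> u" using that(2) u by (auto simp: Q_def)
      then show ?thesis using out[OF that(1)] that(2) by simp
    qed
    ultimately show ?thesis using e'(1) by simp
  qed
  have "partial_colouring (V - Q) f"
    by (rule partial_subset[OF hole_partial[OF h]]) (auto simp: Q_def)
  then show thesis using that[OF Q _ , of f e] main by blast
qed

text \<open>
  For \<open>q\<close> in \<open>Q\<close> let \<open>P q\<close> be its two neighbours outside \<open>Q\<close>, all of which lie in the stable
  set \<open>C\<close> of colour \<open>e\<close>.  Two different pairs already cover \<open>C\<close>, as a vertex of \<open>C\<close> outside both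
  would complete an induced \<open>P\<^sub>4 \<union> K\<^sub>1\<close>.  So \<open>C\<close> has three or four vertices, and a pair
  \<open>P q = {a, b}\<close> exists whose members have at least four neighbours in \<open>Q\<close>.  Such vertices see
  at most \<open>k - 3\<close> colours outside \<open>Q\<close> and can be given distinct new colours \<open>\<beta>\<close>, \<open>\<gamma>\<close> different
  from \<open>e\<close>.  Every vertex of \<open>Q\<close> now has at least \<open>k - 2\<close> available colours, so a set \<open>S\<close>
  violating Hall's condition contains all vertices of \<open>Q\<close> but at most one, and some
  colour other than \<open>e\<close> is unavailable to all vertices of \<open>S\<close>.  That colour is \<open>\<beta>\<close> or \<open>\<gamma>\<close>, hence \<open>a\<close> or \<open>b\<close> is
  adjacent to all of \<open>S\<close>, contrary to \<open>clique_few_nbrs\<close>.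
\<close>

lemma no_critical_graph: False
proof -
  obtain Q f e where Q: "clique Q" "card Q = k" and f: "partial_colouring (V - Q) f"
    and bd: "\<And>u x. u \<in> Q \<Longrightarrow> E u x \<Longrightarrow> x \<notin> Q \<Longrightarrow> f x = e"
    and bd2: "\<And>u. u \<in> Q \<Longrightarrow> card {x. E u x \<and> x \<notin> Q} = 2"
    using monochromatic_boundary by blast
  note QE = cliqueD[OF Q(1)]
  have QV: "Q \<subseteq> V" using Q(1) by (simp add: clique_def)
  have finQ: "finite Q" using QV finite_V finite_subset by blast
  define P where "P u = {x. E u x \<and> x \<notin> Q}" for u
  define C where "C = {x \<in> V - Q. f x = e}"
  define D where "D w = {q \<in> Q. E w q}" for w
  have P2: "card (P u) = 2" if "u \<in> Q" for u using bd2[OF that] by (simp add: P_def)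
  have finP: "finite (P u)" for u
    unfolding P_def using finite_nbrs[of u] by (rule rev_finite_subset) blast
  have PC: "P u \<subseteq> C" if "u \<in> Q" for u
    using bd[OF that] edge_in2 by (auto simp: P_def C_def)
  have finC: "finite C" using finite_V by (simp add: C_def)
  have PD: "w \<in> P q \<longleftrightarrow> q \<in> D w" if "w \<in> C" "q \<in> Q" for w q
    using that edge_sym by (auto simp: P_def D_def C_def)
  have finD: "finite (D w)" for w using finQ by (simp add: D_def)
  have D_le: "card (D w) \<le> k - 2" if "w \<in> C" for w
    using clique_few_nbrs[OF Q, of w] that by (simp add: D_def C_def)
  have stable: "\<not> E x y" if "x \<in> C" "y \<in> C" for x y
    using that f unfolding C_def partial_colouring_def by force
  have cover: "C = P q \<union> P r" if q: "q \<in> Q" and r: "r \<in> Q" and ne: "P q \<noteq> P r" for q r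
  proof
    show "P q \<union> P r \<subseteq> C" using PC q r by blast
    have "\<not> P q \<subseteq> P r" "\<not> P r \<subseteq> P q"
      using card_subset_eq[OF finP[of r], of "P q"] card_subset_eq[OF finP[of q], of "P r"] P2 q r ne
      by auto
    then obtain x y where x: "x \<in> P q" "x \<notin> P r" and y: "y \<in> P r" "y \<notin> P q" by blast
    have xC: "x \<in> C" and yC: "y \<in> C" using x y PC q r by blast+
    show "C \<subseteq> P q \<union> P r"
    proof (rule ccontr)
      assume "\<not> ?thesis"
      then obtain w where w: "w \<in> C" "w \<notin> P q" "w \<notin> P r" by blast
      have "E w x \<or> E w q \<or> E w r \<or> E w y"
      proof (rule dominating_P4)
        show "E x q" "E r y" using x y edge_sym by (auto simp: P_def)
        show "E q r" using QE[OF q r] ne by blast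
        show "\<not> E x r" "\<not> E q y" using x y edge_sym[of x r] xC yC by (auto simp: P_def C_def)
        show "\<not> E x y" using stable xC yC by blast
        show "w \<in> V" using w(1) by (simp add: C_def)
      qed
      then show False
        using stable[OF w(1) xC] stable[OF w(1) yC] w edge_sym[of w] by (auto simp: P_def C_def)
    qed
  qed
  have "\<exists>q\<in>Q. \<forall>w\<in>P q. 4 \<le> card (D w)"
  proof -
    obtain q where q: "q \<in> Q" using Q(2) k_ge by fastforce
    obtain a where a: "a \<in> P q" using P2[OF q] by fastforce
    have "D a \<noteq> Q" using D_le[of a] PC[OF q] a Q(2) k_ge by auto
    then obtain r where r: "r \<in> Q" "a \<notin> P r" using PD[of a] PC[OF q] a by (auto simp: D_def)
    then have qr: "P q \<noteq> P r" using a by blast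
    note Cqr = cover[OF q r(1) qr]
    show ?thesis
    \<comment> \<open>Disjoint pairs mean \<open>card C = 4\<close> and only two pairs overall; otherwise \<open>card C = 3\<close>.\<close>
    proof (cases "P q \<inter> P r = {}")
      case True
      have two: "P s = P q \<or> P s = P r" if s: "s \<in> Q" for s
      proof (rule ccontr)
        assume n: "\<not> ?thesis"
        then have "P r \<subseteq> P s" using cover[OF q s] Cqr True by blast
        then have "P r = P s" using card_subset_eq[OF finP, of "P r" s] P2 r(1) s by simp
        then show False using n by simp
      qed
      define A where "A s = {t \<in> Q. P t = P s}" for s
      have "Q = A q \<union> A r" using two by (auto simp: A_def)
      then have "k \<le> card (A q) + card (A r)" using card_Un_le[of "A q" "A r"] Q(2) by simp
      then have "4 \<le> card (A q) \<or> 4 \<le> card (A r)" using k_ge by linarith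
      then obtain s where s: "s \<in> Q" "4 \<le> card (A s)" using q r(1) by blast
      have "4 \<le> card (D w)" if w: "w \<in> P s" for w
      proof -
        have "A s \<subseteq> D w" using w PD[of w] PC[OF s(1)] by (auto simp: A_def)
        then show ?thesis using s(2) card_mono[OF finD] le_trans by blast
      qed
      then show ?thesis using s(1) by blast
    next
      case False
      have "card C + card (P q \<inter> P r) = 4"
        using card_Un_Int[OF finP[of q] finP[of r]] P2 q r(1) Cqr by simp
      moreover have "card (P q \<inter> P r) \<noteq> 0" using False finP by simp
      moreover have "C \<noteq> P q"
      proof
        assume "C = P q"
        then have "P r \<subseteq> P q" using PC[OF r(1)] by simp
        then have "P r = P q" by (rule card_subset_eq[OF finP]) (simp add: P2 q r(1))
        then show False using qr by simp
      qed
      then have "P q \<subset> C" using PC[OF q] by blast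
      then have "2 < card C" using psubset_card_mono[OF finC] P2[OF q] by metis
      ultimately have C3: "card C = 3" by linarith
      have miss: "P s = C - {w}" if s: "s \<in> Q" "w \<in> C" "w \<notin> P s" for s w
      proof (rule card_subset_eq)
        show "P s \<subseteq> C - {w}" using PC[OF s(1)] s(3) by blast
        show "card (P s) = card (C - {w})" using P2[OF s(1)] C3 finC s(2) by simp
      qed (use finC in simp)
      \<comment> \<open>Each pair omits exactly one vertex of \<open>C\<close>, and each vertex of \<open>C\<close> is omitted at least twice.\<close>
      have M2: "2 \<le> card (Q - D w)" if "w \<in> C" for w
      proof -
        have "D w \<subseteq> Q" by (auto simp: D_def)
        then have "card (Q - D w) = k - card (D w)" using Q(2) finD by (simp add: card_Diff_subset)
        then show ?thesis using D_le[OF that] k_ge by linarith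
      qed
      have "4 \<le> card (D w)" if w: "w \<in> C" for w
      proof -
        have "card (C - {w}) = 2" using C3 w finC by simp
        then obtain x y where xy: "C - {w} = {x, y}" "x \<noteq> y" by (meson card_2_iff)
        then have xyC: "x \<in> C" "y \<in> C" "x \<noteq> w" "y \<noteq> w" by blast+
        have sub: "Q - D z \<subseteq> D w" if "z \<in> C" "z \<noteq> w" for z
        proof
          fix s assume s: "s \<in> Q - D z"
          then have "z \<notin> P s" using PD[OF that(1), of s] by blast
          then have "P s = C - {z}" using miss[of s z] s that(1) by blast
          then show "s \<in> D w" using PD[OF w, of s] w that(2) s by blast
        qed
        have disj: "(Q - D x) \<inter> (Q - D y) = {}"
        proof (rule ccontr)
          assume "\<not> ?thesis"
          then obtain s where s: "s \<in> Q" "s \<notin> D x" "s \<notin> D y" by blast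
          then have "P s = C - {x}" using miss[OF s(1) xyC(1)] PD[OF xyC(1) s(1)] by blast
          moreover have "P s = C - {y}" using miss[OF s(1) xyC(2)] PD[OF xyC(2) s(1)] s(3) by blast
          ultimately show False using xyC(1,2) xy(2) by blast
        qed
        have "2 + 2 \<le> card (Q - D x) + card (Q - D y)" using M2 xyC by (intro add_mono) auto
        also have "\<dots> = card ((Q - D x) \<union> (Q - D y))"
          using disj finQ by (intro card_Un_disjoint[symmetric]) auto
        also have "\<dots> \<le> card (D w)" using sub xyC finD by (intro card_mono) auto
        finally show ?thesis by simp
      qed
      then show ?thesis using q PC by blast
    qed
  qed
  then obtain q where q: "q \<in> Q" and D4: "\<And>w. w \<in> P q \<Longrightarrow> 4 \<le> card (D w)" by blast
  obtain a b where ab: "P q = {a, b}" "a \<noteq> b" using P2[OF q] by (meson card_2_iff)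
  have abC: "a \<in> C" "b \<in> C" using PC[OF q] ab by auto
  define O' where "O' w = f ` {x \<in> V - Q. E w x}" for w
  have O': "finite (O' w)" "card (O' w) \<le> k - 3" if "w \<in> P q" for w
  proof -
    have "card {x \<in> V - Q. E w x} \<le> k + 1 - card (D w)"
    proof (rule outside_nbrs)
      show "w \<in> V" using PC[OF q] that by (auto simp: C_def)
    qed (auto simp: D_def)
    moreover have fin: "finite {x \<in> V - Q. E w x}" using finite_V by simp
    ultimately show "finite (O' w)" "card (O' w) \<le> k - 3"
      using D4[OF that] card_image_le[OF fin, of f] by (auto simp: O'_def)
  qed
  have Oa: "finite (O' a)" "card (O' a) \<le> k - 3" and Ob: "finite (O' b)" "card (O' b) \<le> k - 3"
    using O'[of a] O'[of b] ab by auto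
  have "card (insert e (O' a)) < k"
    using card_insert_le_m1[of "k - 2" "O' a" e] Oa k_ge by simp
  then obtain \<beta> where \<beta>: "\<beta> < k" "\<beta> \<noteq> e" "\<beta> \<notin> O' a"
    using fresh_colour[of "insert e (O' a)"] Oa by auto
  have "card (insert e (O' b)) \<le> k - 2"
    using card_insert_le_m1[of "k - 2" "O' b" e] Ob k_ge by simp
  then have "card (insert \<beta> (insert e (O' b))) < k"
    using card_insert_le_m1[of "k - 1" "insert e (O' b)" \<beta>] k_ge by (simp add: numeral_2_eq_2)
  then obtain \<gamma> where \<gamma>: "\<gamma> < k" "\<gamma> \<noteq> e" "\<gamma> \<noteq> \<beta>" "\<gamma> \<notin> O' b"
    using fresh_colour[of "insert \<beta> (insert e (O' b))"] Ob by auto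
  define g where "g = f(a := \<beta>, b := \<gamma>)"
  have ga: "partial_colouring (V - Q) (f(a := \<beta>))"
  proof (rule partial_update)
    show "partial_colouring (V - Q - {a}) f" using f by (rule partial_subset) blast
    show "f y \<noteq> \<beta>" if "y \<in> V - Q" "E a y" for y using that \<beta>(3) by (auto simp: O'_def)
  qed (use abC \<beta> in \<open>auto simp: C_def\<close>)
  have g: "partial_colouring (V - Q) g" unfolding g_def
  proof (rule partial_update)
    show "partial_colouring (V - Q - {b}) (f(a := \<beta>))" using ga by (rule partial_subset) blast
    show "(f(a := \<beta>)) y \<noteq> \<gamma>" if "y \<in> V - Q" "E b y" for y
      using that \<gamma>(3,4) by (auto simp: O'_def)
  qed (use abC \<gamma> in \<open>auto simp: C_def\<close>)
  obtain S where S: "S \<subseteq> Q" "card (\<Union>(available g Q ` S)) < card S"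
    using marriage_violation[OF QV g] by blast
  have available: "available g Q r = {..<k} - g ` P r" for r by (simp add: available_def P_def)
  have finF: "finite (\<Union>(available g Q ` S))"
    using S(1) finQ finite_subset by (auto simp: available_def)
  have cS: "card S \<le> k" using card_mono[OF finQ S(1)] Q(2) by simp
  obtain s where s: "s \<in> S" using S(2) by fastforce
  then have sQ: "s \<in> Q" using S(1) by blast
  have "card (g ` P s) \<le> 2" using card_image_le[OF finP, of g s] P2[OF sQ] by simp
  then have "k - 2 \<le> card (available g Q s)"
    using diff_card_le_card_Diff[of "g ` P s" "{..<k}"] finP available[of s] by simp
  also have "\<dots> \<le> card (\<Union>(available g Q ` S))" using finF s by (intro card_mono) auto
  finally have low: "k - 1 \<le> card S" using S(2) by linarith
  define M where "M = {..<k} - \<Union>(available g Q ` S)"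
  have M_card: "k + 1 - card S \<le> card M"
    using diff_card_le_card_Diff[OF finF, of "{..<k}"] S(2) unfolding M_def by simp
  have MP: "m \<in> g ` P r" if "m \<in> M" "r \<in> S" for m r
    using that available[of r] by (auto simp: M_def)
  have gC: "g x = e" if "x \<in> C" "x \<noteq> a" "x \<noteq> b" for x using that by (simp add: g_def C_def)
  have "\<exists>m\<in>M. m \<noteq> e"
  proof (cases "card S = k")
    case True
    then have "q \<in> S" using card_subset_eq[OF finQ S(1)] Q(2) q by simp
    obtain m where m: "m \<in> M" using M_card True by fastforce
    have "m \<in> g ` {a, b}" using MP[OF m \<open>q \<in> S\<close>] ab(1) by simp
    then have "m \<noteq> e" using \<beta>(2) \<gamma>(2) ab(2) by (auto simp: g_def)
    then show ?thesis using m by blast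
  next
    case False
    then have "2 \<le> card M" using low cS M_card by linarith
    show ?thesis
    proof (rule ccontr)
      assume "\<not> ?thesis"
      then have "M \<subseteq> {e}" by blast
      then show False using card_mono[of "{e}" M] \<open>2 \<le> card M\<close> by simp
    qed
  qed
  then obtain m where m: "m \<in> M" "m \<noteq> e" by blast
  have hit: "(m = \<beta> \<and> a \<in> P r) \<or> (m = \<gamma> \<and> b \<in> P r)" if r: "r \<in> S" for r
  proof -
    obtain x where x: "x \<in> P r" "m = g x" using MP[OF m(1) r] by blast
    have "x \<in> C" using x(1) PC r S(1) by blast
    then have "x = a \<or> x = b" using gC m(2) x(2) by blast
    then show ?thesis using x ab(2) by (auto simp: g_def)
  qed
  have "\<exists>w\<in>C. \<forall>r\<in>S. w \<in> P r"
    using hit \<gamma>(3) abC by (cases "m = \<beta>") blast+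
  then obtain w where w: "w \<in> C" "\<And>r. r \<in> S \<Longrightarrow> w \<in> P r" by blast
  have "S \<subseteq> D w" using w PD S(1) by blast
  then have "card S \<le> card (D w)" using card_mono[OF finD] by blast
  then show False using low D_le[OF w(1)] k_ge by linarith
qed

end

section \<open>Transfer to graphs\<close>

lemma no_P4_K1:
  assumes G: "pair_graph G" and free: "free_of G P4_K1"
    and arcs: "(a, b) \<in> parcs G" "(b, c) \<in> parcs G" "(c, d) \<in> parcs G"
      "(a, c) \<notin> parcs G" "(a, d) \<notin> parcs G" "(b, d) \<notin> parcs G"
    and x: "x \<in> pverts G" "(x, a) \<notin> parcs G" "(x, b) \<notin> parcs G" "(x, c) \<notin> parcs G" "(x, d) \<notin> parcs G"
  shows False
proof -
  interpret pair_graph G by (rule G)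
  have sym: "(z, y) \<in> parcs G" if "(y, z) \<in> parcs G" for y z
    using arcs_symmetric that by blast
  have loop: "(y, y) \<notin> parcs G" for y using no_loops' by blast
  have inG: "a \<in> pverts G" "b \<in> pverts G" "c \<in> pverts G" "d \<in> pverts G"
    using arcs in_arcsD1 in_arcsD2 by blast+
  define X where "X = {a, b, c, d, x}"
  have dist: "a \<noteq> b" "a \<noteq> c" "a \<noteq> d" "b \<noteq> c" "b \<noteq> d" "c \<noteq> d" "x \<noteq> a" "x \<noteq> b" "x \<noteq> c" "x \<noteq> d"
    using arcs x sym loop by blast+
  have backward: "(c, a) \<notin> parcs G" "(d, a) \<notin> parcs G" "(d, b) \<notin> parcs G"
    "(a, x) \<notin> parcs G" "(b, x) \<notin> parcs G" "(c, x) \<notin> parcs G" "(d, x) \<notin> parcs G"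
    using arcs(4-6) x(2-5) sym by blast+
  define \<phi> :: "nat + nat \<Rightarrow> 'a" where
    "\<phi> = case_sum (\<lambda>i. if i = 0 then a else if i = 1 then b else if i = 2 then c else d) (\<lambda>_. x)"
  have \<phi>: "\<phi> (Inl 0) = a" "\<phi> (Inl 1) = b" "\<phi> (Inl 2) = c" "\<phi> (Inl 3) = d" "\<phi> (Inr 0) = x"
    by (simp_all add: \<phi>_def)
  have \<phi>1: "\<phi> (Inl (Suc 0)) = b" using \<phi>(2) by simp
  have less4: "{..<4::nat} = {0, 1, 2, 3}" by auto
  have verts: "pverts P4_K1 = {Inl 0, Inl 1, Inl 2, Inl 3, Inr 0}"
    by (auto simp: P4_K1_def disjoint_union_def path_graph_def complete_graph_def less4)
  have "{(i, j). i < 4 \<and> j < 4 \<and> (j = Suc i \<or> i = Suc j)}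
      = {(0, 1), (1, 0), (1, 2), (2, 1), (2, 3), (3, 2 :: nat)}"
    by (auto simp: numeral_eq_Suc less_Suc_eq)
  then have parcs: "parcs P4_K1 = {(Inl 0, Inl 1), (Inl 1, Inl 0), (Inl 1, Inl 2), (Inl 2, Inl 1),
      (Inl 2, Inl 3), (Inl 3, Inl 2)}"
    by (auto simp: P4_K1_def disjoint_union_def path_graph_def complete_graph_def)
  define K where "K = \<lparr> pverts = X, parcs = {(y, z) \<in> parcs G. y \<in> X \<and> z \<in> X} \<rparr>"
  have "X \<subseteq> pverts G" using inG x(1) by (simp add: X_def)
  moreover have "wf_digraph (with_proj K)"
    by (auto simp: wf_digraph_def K_def)
  ultimately have "induced_subgraph (with_proj K) (with_proj G)"
    using wf_digraph_axioms by (auto simp: induced_subgraph_def subgraph_def compatible_def K_def)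
  moreover have "digraph_iso (with_proj P4_K1) (with_proj K)"
    unfolding digraph_iso_def
  proof (intro exI conjI)
    let ?h = "\<lparr> iso_verts = \<phi>, iso_arcs = map_prod \<phi> \<phi>, iso_head = snd, iso_tail = fst \<rparr>"
    show "pre_digraph.digraph_isomorphism (with_proj P4_K1) ?h"
      unfolding pre_digraph.digraph_isomorphism_def wf_digraph_def
      using dist by (simp add: verts parcs \<phi> \<phi>1)
    have "{(y, z) \<in> parcs G. y \<in> X \<and> z \<in> X} = {(a, b), (b, a), (b, c), (c, b), (c, d), (d, c)}"
      using arcs x arcs(1-3)[THEN sym] backward loop by (auto simp: X_def)
    then show "with_proj K = app_iso ?h (with_proj P4_K1)"
      by (simp add: app_iso_def with_proj_def verts parcs K_def X_def \<phi> \<phi>1)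
  qed
  ultimately show False using free unfolding free_of_def by blast
qed

theorem mainTheorem2:
  fixes G :: "'a pair_pre_digraph"
  assumes "pair_graph G"
    and "free_of G P4_K1"
    and "max_degree G \<ge> 9"
  shows "chromatic_number G \<le> max (max_degree G - 1) (clique_number G)"
proof -
  interpret pair_graph G by (rule assms(1))
  define k where "k = max (max_degree G - 1) (clique_number G)"
  define colours where "colours W f \<longleftrightarrow> (\<forall>x\<in>W. f x < k) \<and>
    (\<forall>x\<in>W. \<forall>y\<in>W. (x, y) \<in> parcs G \<longrightarrow> f x \<noteq> f y)" for W and f :: "'a \<Rightarrow> nat"
  have "\<exists>f. colours (pverts G) f"
  proof (rule ccontr)
    assume "\<not> ?thesis"
    then have "pverts G \<subseteq> pverts G \<and> (\<forall>f. \<not> colours (pverts G) f)" by blast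
    from ex_has_least_nat[where P = "\<lambda>W. W \<subseteq> pverts G \<and> (\<forall>f. \<not> colours W f)" and m = card, OF this]
    obtain W where min: "(W \<subseteq> pverts G \<and> (\<forall>f. \<not> colours W f)) \<and>
        (\<forall>W'. W' \<subseteq> pverts G \<and> (\<forall>f. \<not> colours W' f) \<longrightarrow> card W \<le> card W')"
      by (rule exE)
    then have W: "W \<subseteq> pverts G" "\<forall>f. \<not> colours W f" by simp_all
    have least: "card W \<le> card W'" if "W' \<subseteq> pverts G" "\<forall>f. \<not> colours W' f" for W'
      using conjunct2[OF min] that by simp
    have finW: "finite W" using finite_subset[OF W(1) pair_finite_verts] .
    define E where "E x y \<longleftrightarrow> x \<in> W \<and> y \<in> W \<and> (x, y) \<in> parcs G" for x y
    have "critical_graph W E k"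
    proof
      show "finite W" by (rule finW)
      show "x \<in> W" if "E x y" for x y using that by (simp add: E_def)
      show "E y x" if "E x y" for x y using that arcs_symmetric[of x y] by (simp add: E_def)
      show "\<not> E x x" for x using no_loops' by (auto simp: E_def)
      show "E x a \<or> E x b \<or> E x c \<or> E x d"
        if "E a b" "E b c" "E c d" "\<not> E a c" "\<not> E a d" "\<not> E b d" "x \<in> W" for a b c d x
        using no_P4_K1[OF assms(1,2), of a b c d x] that W(1) unfolding E_def by blast
      show "card {y. E x y} \<le> k + 1" if "x \<in> W" for x
      proof -
        have fin: "finite (out_arcs (with_proj G) x)"
          by (rule finite_subset[OF _ pair_finite_arcs]) (auto simp: out_arcs_def)
        have "card {y. E x y} = card (Pair x ` {y. E x y})"
          by (simp add: card_image inj_on_def)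
        also have "\<dots> \<le> out_degree (with_proj G) x"
          unfolding out_degree_def using fin by (intro card_mono) (auto simp: E_def)
        also have "\<dots> \<le> max_degree G"
          unfolding max_degree_def using that W(1) pair_finite_verts by (intro Max_ge) auto
        also have "\<dots> \<le> k + 1" by (simp add: k_def)
        finally show ?thesis .
      qed
      show "card C \<le> k" if "C \<subseteq> W" and "\<And>x y. x \<in> C \<Longrightarrow> y \<in> C \<Longrightarrow> x \<noteq> y \<Longrightarrow> E x y" for C
      proof -
        have "is_clique G C" using that W(1) unfolding is_clique_def E_def by blast
        moreover have "finite {C. is_clique G C}"
          by (rule finite_subset[of _ "Pow (pverts G)"]) (auto simp: is_clique_def pair_finite_verts)
        ultimately have "card C \<le> clique_number G"
          unfolding clique_number_def by (intro Max_ge) auto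
        then show ?thesis by (simp add: k_def)
      qed
      show "8 \<le> k" using assms(3) by (simp add: k_def)
      show "\<exists>x y. E x y \<and> f x = f y" if "\<And>x. x \<in> W \<Longrightarrow> f x < k" for f
      proof -
        have "\<not> colours W f" using W(2) by blast
        then show ?thesis using that unfolding colours_def E_def by blast
      qed
      show "\<exists>f. (\<forall>x\<in>W - {v}. f x < k) \<and> (\<forall>x\<in>W - {v}. \<forall>y\<in>W - {v}. E x y \<longrightarrow> f x \<noteq> f y)"
        if v: "v \<in> W" for v
      proof -
        have "card (W - {v}) < card W" using finW v by (rule card_Diff1_less)
        then have "\<not> (\<forall>f. \<not> colours (W - {v}) f)" using least[of "W - {v}"] W(1) by auto
        then obtain f where "colours (W - {v}) f" by blast
        then show ?thesis by (intro exI[of _ f]) (auto simp: colours_def E_def)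
      qed
    qed
    then show False by (rule critical_graph.no_critical_graph)
  qed
  then obtain f where "colours (pverts G) f" by blast
  then have "proper_colouring G k f"
    using in_arcsD1 in_arcsD2 by (fastforce simp: colours_def proper_colouring_def)
  then show ?thesis unfolding chromatic_number_def k_def[symmetric] by (intro Least_le) blast
qed

end
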